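(* Let $S=(S_n)_{n\ge0}$ be a random walk with non-degenerate i.i.d. real steps $X_i$ and $S_0=0$, let $R_n$ be its number of weak records up to step $n$, and let $T_1$ be the waiting time for the first weak record after time $0$. Let $\Lambda(\lambda)=\log\mathrm{E}(e^{\lambda T_1})$ for $\lambda\le0$ and $\Lambda^*(y)=\sup_{\lambda\le0}(\lambda y-\Lambda(\lambda))$. (a) If $S$ oscillates, then for every $0<y\le1$, $$\lim_{n\to\infty}\frac1n\log\mathrm{P}(R_n\ge ny)=-y\,\Lambda^*\!\left(\tfrac1y\right),$$ where $$\Lambda^*(y)=\begin{cases}(\Lambda')^{-1}(y)\cdot y-\Lambda\big[(\Lambda')^{-1}(y)\big],&y>1,\\-\log\mathrm{P}(X_1\ge0),&y=1,\\+\infty,&y<1.\end{cases}$$ (b) If $S$ drifts to $+\infty$, then $R_n/n\to1/\mathrm{E}(T_1)$ a.s., where $\mathrm{E}(T_1)=\exp\big\{\sum_{k=1}^\infty\frac{\mathrm{P}(S_k<0)}{k}\big\}<+\infty$, and for every $1/\mathrm{E}(T_1)<y\le1$, $$\lim_{n\to\infty}\frac1n\log\mathrm{P}(R_n\ge ny)=-y\,\Lambda^*\!\left(\tfrac1y\right),$$ where $$\Lambda^*(y)=\begin{cases}(\Lambda')^{-1}(y)\cdot y-\Lambda\big[(\Lambda')^{-1}(y)\big],&1<y<\mathrm{E}(T_1),\\-\log\mathrm{P}(X_1\ge0),&y=1,\\+\infty,&y<1.\end{cases}$$ Here $\Lambda'$ is the derivative of $\Lambda$ and $(\Lambda')^{-1}$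 is the inverse of $\Lambda'$ restricted to $(-\infty,0)$.
   Context: $X_1,X_2,\dots$ are i.i.d. non-degenerate real random variables, $S_0=0$, $S_n=\sum_{i=1}^nX_i$. A weak record occurs at step $n$ if $S_n=\max_{0\le k\le n}S_k$; $S_0$ is counted as the first record. $R_n$ is the number of weak records among steps $0,1,\dots,n$ (so $R_0=1$). $T_1=\inf\{n\ge1:S_n\ge S_j\text{ for all }0\le j\le n\}$ is the first weak ladder epoch. The walk oscillates if $\limsup_n S_n=+\infty$ and $\liminf_nS_n=-\infty$ a.s.; it drifts to $+\infty$ if $S_n\to+\infty$ a.s. *)

theory Defs
  imports "HOL-Probability.Probability"
begin

text \<open>The steps are \<open>X 1, X 2, \<dots>\<close>; the value \<open>X 0\<close> is never used.\<close>

definition iid_nondegenerate_steps :: "'a measure \<Rightarrow> (nat \<Rightarrow> 'a \<Rightarrow> real) \<Rightarrow> bool" where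
  "iid_nondegenerate_steps M X \<longleftrightarrow>
     prob_space.indep_vars M (\<lambda>_. borel) X {1..} \<and>
     (\<forall>i\<ge>1. distr M borel (X i) = distr M borel (X 1)) \<and>
     \<not> (\<exists>c. AE \<omega> in M. X 1 \<omega> = c)"

definition walk :: "(nat \<Rightarrow> 'a \<Rightarrow> real) \<Rightarrow> nat \<Rightarrow> 'a \<Rightarrow> real" where
  "walk X n \<omega> = (\<Sum>i=1..n. X i \<omega>)"

definition weak_record_at :: "(nat \<Rightarrow> 'a \<Rightarrow> real) \<Rightarrow> nat \<Rightarrow> 'a \<Rightarrow> bool" where
  "weak_record_at X n \<omega> \<longleftrightarrow> walk X n \<omega> = Max ((\<lambda>k. walk X k \<omega>) ` {0..n})"

definition num_records :: "(nat \<Rightarrow> 'a \<Rightarrow> real) \<Rightarrow> nat \<Rightarrow> 'a \<Rightarrow> nat" where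
  "num_records X n \<omega> = card {k \<in> {0..n}. weak_record_at X k \<omega>}"

text \<open>The infimum is taken in \<^typ>\<open>enat\<close>, so the epoch is \<open>\<infinity>\<close> if there is no further record.\<close>

definition ladder_epoch :: "(nat \<Rightarrow> 'a \<Rightarrow> real) \<Rightarrow> 'a \<Rightarrow> enat" where
  "ladder_epoch X \<omega> =
     Inf (enat ` {n. 1 \<le> n \<and> (\<forall>j\<in>{0..n}. walk X j \<omega> \<le> walk X n \<omega>)})"

definition oscillates :: "'a measure \<Rightarrow> (nat \<Rightarrow> 'a \<Rightarrow> real) \<Rightarrow> bool" where
  "oscillates M X \<longleftrightarrow>
     (AE \<omega> in M. limsup (\<lambda>n. ereal (walk X n \<omega>)) = \<infinity> \<and>
                 liminf (\<lambda>n. ereal (walk X n \<omega>)) = - \<infinity>)"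

definition drifts_to_infinity :: "'a measure \<Rightarrow> (nat \<Rightarrow> 'a \<Rightarrow> real) \<Rightarrow> bool" where
  "drifts_to_infinity M X \<longleftrightarrow>
     (AE \<omega> in M. filterlim (\<lambda>n. walk X n \<omega>) at_top sequentially)"

definition mean_ladder_epoch :: "'a measure \<Rightarrow> (nat \<Rightarrow> 'a \<Rightarrow> real) \<Rightarrow> ennreal" where
  "mean_ladder_epoch M X = (\<integral>\<^sup>+ \<omega>. ennreal_of_enat (ladder_epoch X \<omega>) \<partial>M)"

text \<open>\<open>e\<^sup>\<lambda>\<^sup>t\<close> for \<open>\<lambda> \<le> 0\<close> and \<open>t \<in> {0, 1, \<dots>, \<infinity>}\<close>, with \<open>0 \<cdot> \<infinity> = 0\<close> and \<open>e\<close> to the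
  power \<open>- \<infinity>\<close> equal to \<open>0\<close>.\<close>

definition exp_enat :: "real \<Rightarrow> enat \<Rightarrow> real" where
  "exp_enat l t =
     (case t of enat n \<Rightarrow> exp (l * real n) | \<infinity> \<Rightarrow> (if l = 0 then 1 else 0))"

text \<open>Only the values for \<open>l \<le> 0\<close> are meaningful.\<close>

definition log_mgf :: "'a measure \<Rightarrow> (nat \<Rightarrow> 'a \<Rightarrow> real) \<Rightarrow> real \<Rightarrow> real" where
  "log_mgf M X l = ln (\<integral>\<omega>. exp_enat l (ladder_epoch X \<omega>) \<partial>M)"

definition rate :: "'a measure \<Rightarrow> (nat \<Rightarrow> 'a \<Rightarrow> real) \<Rightarrow> real \<Rightarrow> ereal" where
  "rate M X y = (SUP l\<in>{..0}. ereal (l * y - log_mgf M X l))"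

definition inv_deriv_log_mgf :: "'a measure \<Rightarrow> (nat \<Rightarrow> 'a \<Rightarrow> real) \<Rightarrow> real \<Rightarrow> real" where
  "inv_deriv_log_mgf M X = inv_into {..<0} (deriv (log_mgf M X))"

text \<open>Logarithm of a probability, with \<open>log 0 = - \<infinity>\<close> (whereas \<^term>\<open>ln (0::real) = 0\<close>).\<close>

definition elog :: "real \<Rightarrow> ereal" where
  "elog p = (if p \<le> 0 then - \<infinity> else ereal (ln p))"

end

(*
  After its first weak record the walk starts afresh, so the record times are sums of independent
  copies of T = T_1 and R_n >= m + 1 iff the sum of m copies is at most n.

  Large deviations are therefore those of Cramer for the lower tail: Chernoff from above and,
  from below, a change of measure under which both deviations of the sum are again estimated by
  Chernoff bounds. The transform is E exp (l (T - y)), which is convex in l term by term; its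
  minimiser over l < 0 is the solution of Lambda'(l) = y.

  Reversing the path, P(n is a record) = P(S_k >= 0 for all k <= n), which decreases to
  q = P(S_k >= 0 for all k). The renewal equation gives q E(T) = 1. Here q = 0 if the walk
  oscillates, and q > 0 if it drifts to infinity, since then it has a last minimum.
  Rotating a path of length n cyclically to its last maximum yields
  P(S_n >= 0) = sum_k k P(T = k) P(n - k is a record), from which the exponential formula for
  E(T) follows by generating functions.

  The law of large numbers for R_n / n is proved without reference to the sequence of all record
  times: the upper bound is Chernoff and Borel-Cantelli, the lower bound follows from the
  subadditivity of R_n under shifts by a greedy covering argument.
*)

theory Submission
  imports Defs
begin

section \<open>Exponential moments of the first record time\<close>

text \<open>E(T) may be infinite, so nothing can rest on a derivative of the transform at
  \<open>0\<close>. That a level \<open>y\<close> lies below E(T) is carried throughout by a finite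
  certificate, a partial sum of P(T > n) that exceeds \<open>y\<close>; this treats oscillation and
  drift alike and yields the root of Lambda'(l) = y by the intermediate value theorem. At level one
  there is in general no such root: the supremum is approached as \<open>l\<close> tends to
  -\<infinity>, and the lower bound comes from all waiting times being equal to one. The analysis
  concerns number sequences in abstract locales (the law of T, the laws of its sums, the renewal
  sequence, P(S_n >= 0)); probability only has to supply their identities. These are proved on the
  canonical space of step sequences, where shift, reversal and rotation are relabellings of
  coordinates, and the given walk is transported there at the end. In the law of large numbers, the
  role of ergodicity is played by an event that is shift invariant up to null sets and hence
  independent of a record at any fixed time.\<close>

lemma exp_gt_add_one_self:
  fixes x :: real
  assumes "x \<noteq> 0"
  shows "1 + x < exp x"
proof (cases "1 + x / 2 \<ge> 0")
  case True
  \<comment> \<open>The square exceeds \<open>1 + x\<close> by the positive term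
    \<open>x * x / 4\<close>.\<close>
  have "1 + x < (1 + x / 2)\<^sup>2"
    using assms by (simp add: power2_sum power_divide)
  also have "\<dots> \<le> exp (x / 2) ^ 2"
    using True by (intro power_mono) auto
  also have "\<dots> = exp x"
    by (simp add: exp_double[symmetric])
  finally show ?thesis .
next
  case False
  then show ?thesis using exp_gt_zero[of x] by linarith
qed

lemma sums_strict_mono:
  fixes a b :: "nat \<Rightarrow> real"
  assumes "a sums s" "b sums t" "\<And>n. a n \<le> b n" "a k < b k"
  shows "s < t"
proof -
  have "0 < (\<Sum>n. b n - a n)"
    using assms by (intro suminf_pos2[of _ k] summable_diff) (auto simp: sums_iff)
  then show ?thesis
    using suminf_diff[of b a] assms by (simp add: sums_iff)
qed

text \<open>The law of an almost surely finite waiting time, \<open>f n = P(T = n)\<close>, detached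
  from any probability space. The mean may be infinite, which is why derivatives appear only for
  \<open>l < 0\<close>.\<close>

locale waiting_time =
  fixes f :: "nat \<Rightarrow> real"
  assumes f_nonneg: "f n \<ge> 0"
    and f_0: "f 0 = 0"
    and f_1: "f 1 > 0"
    and f_sums: "f sums 1"
begin

definition Phi :: "real \<Rightarrow> real" where
  "Phi l = (\<Sum>n. f n * exp (l * real n))"

definition Phi' :: "real \<Rightarrow> real" where
  "Phi' l = (\<Sum>n. real n * f n * exp (l * real n))"

lemma summable_Phi:
  assumes "l \<le> 0"
  shows "summable (\<lambda>n. f n * exp (l * real n))"
proof (rule summable_comparison_test')
  show "summable f" using f_sums by (rule sums_summable)
  show "norm (f n * exp (l * real n)) \<le> f n" for n
    using f_nonneg[of n] assms by (simp add: mult_left_le mult_nonpos_nonneg)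
qed

lemma Phi_0: "Phi 0 = 1"
  using f_sums by (simp add: Phi_def sums_iff)

lemma Phi_powser: "Phi l = (\<Sum>n. f n * exp l ^ n)"
  by (simp add: Phi_def exp_of_nat2_mult)

text \<open>In the variable \<open>s = exp l\<close> the transform is a power series that converges
  at \<open>s = 1\<close>, so termwise differentiation is legitimate for \<open>s < 1\<close>, that
  is for \<open>l < 0\<close>.\<close>

lemma Phi'_sums:
  assumes "l < 0"
  shows "(\<lambda>n. real n * f n * exp (l * real n)) sums (exp l * (\<Sum>n. diffs f n * exp l ^ n))"
proof -
  have "summable (\<lambda>n. f n * 1 ^ n)"
    using f_sums by (simp add: sums_iff)
  then have "summable (\<lambda>n. f n * x ^ n)" if "norm x < 1" for x :: real
    using that by (intro powser_inside[of f 1 x]) auto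
  then have "summable (\<lambda>n. diffs f n * exp l ^ n)"
    using assms by (intro termdiff_converges[of _ 1]) auto
  from sums_mult[OF diffs_equiv[OF this], of "exp l"]
  show ?thesis
  proof (rule sums_cong[THEN iffD1, rotated])
    show "exp l * (real n * f n * exp l ^ (n - Suc 0)) = real n * f n * exp (l * real n)" for n
      unfolding exp_of_nat2_mult by (cases n) simp_all
  qed
qed

lemma summable_Phi': "l < 0 \<Longrightarrow> summable (\<lambda>n. real n * f n * exp (l * real n))"
  using Phi'_sums by (rule sums_summable)

lemma Phi'_powser: "l < 0 \<Longrightarrow> Phi' l = exp l * (\<Sum>n. diffs f n * exp l ^ n)"
  unfolding Phi'_def using Phi'_sums by (simp add: sums_iff)

lemma Phi_deriv:
  assumes "l < 0"
  shows "(Phi has_real_derivative Phi' l) (at l)"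
proof -
  have "summable (\<lambda>n. f n * 1 ^ n)"
    using f_sums by (simp add: sums_iff)
  from termdiffs_strong[OF this, of "exp l"]
  have "((\<lambda>x. \<Sum>n. f n * x ^ n) has_real_derivative (\<Sum>n. diffs f n * exp l ^ n)) (at (exp l))"
    using assms by simp
  from DERIV_chain2[OF this DERIV_exp] show ?thesis
    using assms unfolding Phi_powser[abs_def] by (simp add: Phi'_powser mult.commute)
qed

lemma Phi_ge:
  assumes "l \<le> 0"
  shows "f 1 * exp l \<le> Phi l"
proof -
  have "(\<Sum>n\<in>{1}. f n * exp (l * real n)) \<le> Phi l"
    unfolding Phi_def using f_nonneg by (intro sum_le_suminf summable_Phi assms) auto
  then show ?thesis by simp
qed

lemma Phi_pos: "l \<le> 0 \<Longrightarrow> Phi l > 0"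
  using Phi_ge[of l] f_1 by (smt (verit) exp_gt_zero mult_pos_pos)

lemma Phi_le:
  assumes "l \<le> 0"
  shows "Phi l \<le> exp l"
proof -
  have "Phi l \<le> (\<Sum>n. f n * exp l)"
    unfolding Phi_def
  proof (rule suminf_le)
    show "summable (\<lambda>n. f n * exp l)" using f_sums by (intro summable_mult2 sums_summable)
    show "f n * exp (l * real n) \<le> f n * exp l" for n
    proof (cases "n = 0")
      case False
      then have "l * real n \<le> l * 1" using assms by (intro mult_left_mono_neg) auto
      then show ?thesis using f_nonneg[of n] by (intro mult_left_mono) auto
    qed (simp add: f_0)
  qed (rule summable_Phi[OF assms])
  also have "\<dots> = exp l" using f_sums by (simp add: sums_iff suminf_mult2[symmetric])
  finally show ?thesis .
qed

definition Lam :: "real \<Rightarrow> real" where "Lam l = ln (Phi l)"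

lemma Lam_deriv: "l < 0 \<Longrightarrow> (Lam has_real_derivative Phi' l / Phi l) (at l)"
  unfolding Lam_def using Phi_pos[of l] Phi_deriv[of l]
  by (auto intro!: derivative_eq_intros)

text \<open>\<open>tilt y l\<close> is the derivative of \<open>l \<mapsto> E exp (l (T - y))\<close>, which is convex termwise.\<close>

definition tilt :: "real \<Rightarrow> real \<Rightarrow> real" where
  "tilt y l = exp (- l * y) * (Phi' l - y * Phi l)"

lemma tilt_sums:
  assumes "l < 0"
  shows "(\<lambda>n. f n * ((real n - y) * exp (l * (real n - y)))) sums tilt y l"
proof -
  have "(\<lambda>n. exp (- l * y) * (real n * f n * exp (l * real n) - y * (f n * exp (l * real n))))
      sums tilt y l"
    unfolding tilt_def Phi'_def Phi_def
    by (intro sums_mult sums_diff summable_sums summable_Phi' summable_Phi) (use assms in auto)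
  moreover have "exp (- l * y) * (real n * f n * exp (l * real n) - y * (f n * exp (l * real n)))
      = f n * ((real n - y) * exp (l * (real n - y)))" for n
  proof -
    have "exp (l * (real n - y)) = exp (l * real n) * exp (- l * y)"
      by (simp add: exp_add[symmetric] algebra_simps)
    then show ?thesis by (simp add: algebra_simps)
  qed
  ultimately show ?thesis by simp
qed

lemma tilt_eq_0: "tilt y l = 0 \<longleftrightarrow> Phi' l = y * Phi l"
  by (simp add: tilt_def)

text \<open>Each \<open>x * exp (l * x)\<close> is nondecreasing in \<open>l\<close> whatever the
  sign of \<open>x\<close>; the strict increase comes from the term \<open>n = 1\<close>, where
  \<open>1 - y\<close> is nonzero and \<open>f 1\<close> is positive.\<close>

lemma tilt_strict_mono:
  assumes "l < m" "m < 0" "y > 1"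
  shows "tilt y l < tilt y m"
proof (rule sums_strict_mono[OF tilt_sums tilt_sums])
  have *: "(x * exp (l * x)) \<le> x * exp (m * x)" for x :: real
  proof (cases "x \<ge> 0")
    case True
    then show ?thesis using assms by (intro mult_left_mono) (auto intro: mult_right_mono)
  next
    case False
    then show ?thesis using assms by (intro mult_left_mono_neg) (auto intro: mult_right_mono_neg)
  qed
  show "f n * ((real n - y) * exp (l * (real n - y))) \<le> f n * ((real n - y) * exp (m * (real n - y)))" for n
    by (intro mult_left_mono * f_nonneg)
  have "exp (m * (1 - y)) < exp (l * (1 - y))"
    using assms by simp
  then show "f 1 * ((real 1 - y) * exp (l * (real 1 - y))) < f 1 * ((real 1 - y) * exp (m * (real 1 - y)))"
    using f_1 assms by simp
qed (use assms in auto)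

text \<open>Termwise the exponential lies above its tangent at \<open>l\<close>, and the slopes of
  the tangents add up to \<open>tilt y l = 0\<close>. The strict term \<open>n = 1\<close> is the
  origin of the factors below one in the lower deviation bound. The comparison point
  \<open>m = 0\<close> is included.\<close>

lemma normalized_minimum:
  assumes "l < 0" "m \<le> 0" "m \<noteq> l" "tilt y l = 0" "y > 1"
  shows "exp (- l * y) * Phi l < exp (- m * y) * Phi m"
proof -
  have K: "(\<lambda>n. f n * exp (z * (real n - y))) sums (exp (- z * y) * Phi z)" if "z \<le> 0" for z
  proof -
    have "(\<lambda>n. exp (- z * y) * (f n * exp (z * real n))) sums (exp (- z * y) * Phi z)"
      unfolding Phi_def using that by (intro sums_mult summable_sums summable_Phi)
    moreover have "exp (- z * y) * (f n * exp (z * real n)) = f n * exp (z * (real n - y))" for n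
      by (simp add: mult.left_commute[of _ "f n"] exp_add[symmetric] algebra_simps)
    ultimately show ?thesis by (simp only:)
  qed
  have tangent: "exp (l * x) + (m - l) * (x * exp (l * x)) \<le> exp (m * x)" for x :: real
  proof -
    have "exp (l * x) * (1 + (m - l) * x) \<le> exp (l * x) * exp ((m - l) * x)"
      by (intro mult_left_mono exp_ge_add_one_self) auto
    also have "\<dots> = exp (m * x)" by (simp add: exp_add[symmetric] algebra_simps)
    finally show ?thesis by (simp add: algebra_simps)
  qed
  have strict: "exp (l * x) + (m - l) * (x * exp (l * x)) < exp (m * x)" if "x \<noteq> 0" for x :: real
  proof -
    have "exp (l * x) * (1 + (m - l) * x) < exp (l * x) * exp ((m - l) * x)"
      using that assms by (intro mult_strict_left_mono exp_gt_add_one_self) auto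
    also have "\<dots> = exp (m * x)" by (simp add: exp_add[symmetric] algebra_simps)
    finally show ?thesis by (simp add: algebra_simps)
  qed
  have "exp (- l * y) * Phi l + (m - l) * tilt y l < exp (- m * y) * Phi m"
  proof (rule sums_strict_mono)
    show "(\<lambda>n. f n * exp (l * (real n - y)) + (m - l) * (f n * ((real n - y) * exp (l * (real n - y)))))
       sums (exp (- l * y) * Phi l + (m - l) * tilt y l)"
      by (intro sums_add sums_mult K tilt_sums) (use assms in auto)
    show "(\<lambda>n. f n * exp (m * (real n - y))) sums (exp (- m * y) * Phi m)"
      by (rule K) fact
    show "f n * exp (l * (real n - y)) + (m - l) * (f n * ((real n - y) * exp (l * (real n - y))))
      \<le> f n * exp (m * (real n - y))" for n
      using mult_left_mono[OF tangent[of "real n - y"] f_nonneg[of n]] by (simp add: algebra_simps)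
    show "f 1 * exp (l * (real 1 - y)) + (m - l) * (f 1 * ((real 1 - y) * exp (l * (real 1 - y))))
      < f 1 * exp (m * (real 1 - y))"
      using mult_strict_left_mono[OF strict[of "1 - y"] f_1] assms by (simp add: algebra_simps)
  qed
  then show ?thesis using assms by simp
qed

lemma Phi_le_1: "l \<le> 0 \<Longrightarrow> Phi l \<le> 1"
  using Phi_le[of l] by (smt (verit) exp_le_one_iff)

lemma isCont_diffs:
  assumes "\<bar>s\<bar> < 1"
  shows "isCont (\<lambda>s. \<Sum>n. diffs f n * s ^ n) s"
proof -
  have "summable (\<lambda>n. f n * 1 ^ n)"
    using f_sums by (simp add: sums_iff)
  then have "summable (\<lambda>n. f n * x ^ n)" if "norm x < 1" for x :: real
    using that by (intro powser_inside[of f 1 x]) auto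
  then have "summable (\<lambda>n. diffs f n * ((1 + \<bar>s\<bar>) / 2) ^ n)"
    using assms by (intro termdiff_converges[of _ 1]) auto
  then show ?thesis
    by (rule isCont_powser) (use assms in auto)
qed

lemma continuous_on_tilt: "continuous_on {..<0} (tilt y)"
proof (rule continuous_at_imp_continuous_on, rule ballI)
  fix l :: real assume "l \<in> {..<0}"
  then have l: "l < 0" by simp
  have "isCont (\<lambda>l. exp (- l * y) * (exp l * (\<Sum>n. diffs f n * exp l ^ n) - y * Phi l)) l"
    using DERIV_isCont[OF Phi_deriv[OF l]] isCont_o2[OF isCont_exp, of l "\<lambda>s. \<Sum>n. diffs f n * s ^ n"] isCont_diffs[of "exp l"] l
    by (intro continuous_intros) auto
  moreover have "eventually (\<lambda>l. tilt y l = exp (- l * y) * (exp l * (\<Sum>n. diffs f n * exp l ^ n) - y * Phi l)) (nhds l)"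
    using eventually_nhds_in_open[of "{..<0}" l] l by (auto elim!: eventually_mono simp: tilt_def Phi'_powser)
  ultimately show "isCont (tilt y) l"
    by (simp add: isCont_cong)
qed

text \<open>\<open>K\<close> certifies that the mean, finite or not, exceeds \<open>y\<close>. Then
  \<open>tilt y\<close> is positive somewhere close to \<open>0\<close> and negative far to the
  left.\<close>

lemma tilt_root_exists:
  assumes "y > 1" and K: "(\<Sum>k<K. real k * f k) > y"
  shows "\<exists>l<0. tilt y l = 0"
proof -
  \<comment> \<open>From index \<open>K'\<close> on, \<open>real n - y\<close> is nonnegative, so
    truncating the series there leaves a lower bound.\<close>
  define K' where "K' = max K (nat \<lceil>y\<rceil>)"
  have "(\<Sum>n<K'. f n) \<le> 1"
    using f_sums f_nonneg sum_le_suminf[of f "{..<K'}"] by (auto simp: sums_iff)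
  moreover have "(\<Sum>k<K. real k * f k) \<le> (\<Sum>k<K'. real k * f k)"
    using f_nonneg by (intro sum_mono2) (auto simp: K'_def)
  moreover have "(\<Sum>n<K'. f n * (real n - y)) = (\<Sum>k<K'. real k * f k) - y * (\<Sum>n<K'. f n)"
    by (simp add: sum_subtractf sum_distrib_left algebra_simps)
  moreover have "y * (\<Sum>n<K'. f n) \<le> y * 1"
    using calculation(1) assms by (intro mult_left_mono) auto
  ultimately have lim_pos: "0 < (\<Sum>n<K'. f n * (real n - y) * exp (0 * (real n - y)))"
    using K by simp
  have "((\<lambda>l. \<Sum>n<K'. f n * (real n - y) * exp (l * (real n - y))) \<longlongrightarrow> (\<Sum>n<K'. f n * (real n - y) * exp (0 * (real n - y)))) (at_left 0)"
    by (intro tendsto_intros)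
  from order_tendstoD(1)[OF this lim_pos]
  have "\<forall>\<^sub>F l in at_left 0. 0 < (\<Sum>n<K'. f n * (real n - y) * exp (l * (real n - y)))"
    .
  then have "\<forall>\<^sub>F l in at_left 0. l < 0 \<and> 0 < (\<Sum>n<K'. f n * (real n - y) * exp (l * (real n - y)))"
    by (rule eventually_conj[rotated]) (simp add: eventually_at_filter)
  then obtain l1 where l1: "l1 < 0" "0 < (\<Sum>n<K'. f n * (real n - y) * exp (l1 * (real n - y)))"
    using eventually_happens'[OF trivial_limit_at_left_real] by blast
  have "(\<Sum>n<K'. f n * ((real n - y) * exp (l1 * (real n - y)))) \<le> tilt y l1"
    using tilt_sums[OF l1(1), of y] f_nonneg
    by (subst sums_unique[OF tilt_sums[OF l1(1)]], intro sum_le_suminf)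
       (auto simp: sums_iff K'_def intro!: mult_nonneg_nonneg)
  then have pos: "0 < tilt y l1"
    using l1 by (simp add: mult.assoc)
  \<comment> \<open>Far to the left the first term dominates: \<open>Phi' l\<close> is close to
    \<open>f 1 * exp l\<close>, hence below \<open>y * Phi l\<close> because
    \<open>y > 1\<close>.\<close>
  have "((\<lambda>s. \<Sum>n. diffs f n * s ^ n) \<longlongrightarrow> (\<Sum>n. diffs f n * 0 ^ n)) (at 0)"
    using isCont_diffs[of 0] unfolding isCont_def by simp
  then have "((\<lambda>s. \<Sum>n. diffs f n * s ^ n) \<longlongrightarrow> f 1) (at 0)"
    by (simp add: diffs_def)
  moreover have "filterlim exp (at 0) (at_bot :: real filter)"
    unfolding filterlim_at using exp_at_bot by auto
  ultimately have "((\<lambda>l. \<Sum>n. diffs f n * exp l ^ n) \<longlongrightarrow> f 1) at_bot"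
    by (rule filterlim_compose)
  moreover have "f 1 < y * f 1" using assms f_1 by simp
  ultimately have "\<forall>\<^sub>F l in at_bot. (\<Sum>n. diffs f n * exp l ^ n) < y * f 1"
    by (rule order_tendstoD)
  then have "\<forall>\<^sub>F l in at_bot. l < l1 \<and> (\<Sum>n. diffs f n * exp l ^ n) < y * f 1"
    by (intro eventually_conj eventually_gt_at_bot)
  then obtain l0 where l0: "l0 < l1" "(\<Sum>n. diffs f n * exp l0 ^ n) < y * f 1"
    using eventually_happens'[OF trivial_limit_at_bot_linorder] by blast
  have "Phi' l0 < exp l0 * (y * f 1)"
    using l0 l1 by (simp add: Phi'_powser)
  also have "\<dots> = y * (f 1 * exp l0)" by simp
  also have "\<dots> \<le> y * Phi l0"
    using l0 l1 assms by (intro mult_left_mono Phi_ge) auto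
  finally have neg: "tilt y l0 < 0"
    by (simp add: tilt_def mult_pos_neg)
  have "\<exists>l\<ge>l0. l \<le> l1 \<and> tilt y l = 0"
    using neg pos l0 l1 by (intro IVT' continuous_on_subset[OF continuous_on_tilt]) auto
  then show ?thesis using l1(1) order.strict_trans1 by blast
qed

text \<open>At the root \<open>m\<close> for the larger level,
  \<open>Phi' m = c * Phi m > a * Phi m\<close>, so \<open>tilt a\<close> is already positive there.
  This is the monotonicity of the inverse of Lambda'.\<close>

lemma tilt_root_mono:
  assumes "1 < a" "a < c" "l < 0" "m < 0" "tilt a l = 0" "tilt c m = 0"
  shows "l < m"
proof (rule ccontr)
  assume "\<not> l < m"
  have "a * Phi m < c * Phi m"
    using assms Phi_pos[of m] by simp
  then have "tilt a m > 0"
    using assms by (simp add: tilt_def)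
  moreover have "tilt a m \<le> tilt a l"
    using \<open>\<not> l < m\<close> tilt_strict_mono[of m l a] assms by (cases "l = m") auto
  ultimately show False using assms by simp
qed

lemma deriv_Lam: "l < 0 \<Longrightarrow> deriv Lam l = y \<longleftrightarrow> tilt y l = 0"
  using Phi_pos[of l] DERIV_imp_deriv[OF Lam_deriv, of l] by (auto simp: tilt_eq_0 field_simps)

lemma tilt_root_unique:
  assumes "y > 1" "l < 0" "tilt y l = 0" "m < 0" "tilt y m = 0"
  shows "l = m"
  using tilt_strict_mono[of l m y] tilt_strict_mono[of m l y] assms by (cases l m rule: linorder_cases) auto

section \<open>The Legendre transform above, at and below level one\<close>

definition legendre :: "real \<Rightarrow> ereal" where
  "legendre y = (SUP l\<in>{..0}. ereal (l * y - Lam l))"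

lemma exp_Lam: "l \<le> 0 \<Longrightarrow> exp (Lam l) = Phi l"
  using Phi_pos[of l] by (simp add: Lam_def)

text \<open>Since \<open>exp (- (m * y - Lam m)) = exp (- m * y) * Phi m\<close>, the supremum is
  attained where the normalised transform is minimal.\<close>

lemma legendre_root:
  assumes "y > 1" "l < 0" "tilt y l = 0"
  shows "legendre y = ereal (l * y - Lam l)"
  unfolding legendre_def
proof (rule antisym[OF SUP_least SUP_upper])
  fix m :: real assume m: "m \<in> {..0}"
  have "exp (- (l * y - Lam l)) \<le> exp (- (m * y - Lam m))"
    using normalized_minimum[of l m y] assms m exp_Lam[of l] exp_Lam[of m]
    by (cases "m = l") (auto simp: exp_diff exp_minus field_simps)
  then show "ereal (m * y - Lam m) \<le> ereal (l * y - Lam l)" by simp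
qed (use assms in auto)

text \<open>The comparison is with \<open>m = 0\<close>, where the exponent vanishes. A positive
  rate makes the Chernoff bounds summable later.\<close>

lemma legendre_root_pos:
  assumes "y > 1" "l < 0" "tilt y l = 0"
  shows "l * y - Lam l > 0"
proof -
  have "exp (- (l * y - Lam l)) < 1"
    using normalized_minimum[of l 0 y] assms exp_Lam[of l] Phi_0
    by (auto simp: exp_diff exp_minus field_simps)
  then show ?thesis by simp
qed

lemma legendre_one_approx:
  assumes "e > 0"
  shows "\<exists>l<0. l - Lam l > - ln (f 1) - e"
proof -
  have "\<bar>x\<bar> < 1 \<Longrightarrow> summable (\<lambda>n. f (Suc n) * x ^ n)" for x :: real
  proof -
    assume "\<bar>x\<bar> < 1"
    moreover have "summable (\<lambda>n. f (Suc n) * 1 ^ n)"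
      using f_sums summable_ignore_initial_segment[of f 1] by (simp add: sums_iff)
    ultimately show ?thesis by (intro powser_inside[of _ 1 x]) auto
  qed
  note summ = this
  have "isCont (\<lambda>s. \<Sum>n. f (Suc n) * s ^ n) 0"
    using summ[of "1/2"] by (rule isCont_powser) auto
  then have "((\<lambda>s. \<Sum>n. f (Suc n) * s ^ n) \<longlongrightarrow> f 1) (at 0)"
    unfolding isCont_def by simp
  moreover have "filterlim exp (at 0) (at_bot :: real filter)"
    unfolding filterlim_at using exp_at_bot by auto
  ultimately have "((\<lambda>l. \<Sum>n. f (Suc n) * exp l ^ n) \<longlongrightarrow> f 1) at_bot"
    by (rule filterlim_compose)
  moreover have "f 1 < exp e * f 1" using assms f_1 by simp
  ultimately have "\<forall>\<^sub>F l in at_bot. (\<Sum>n. f (Suc n) * exp l ^ n) < exp e * f 1"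
    by (rule order_tendstoD)
  then have "\<forall>\<^sub>F l in at_bot. l < 0 \<and> (\<Sum>n. f (Suc n) * exp l ^ n) < exp e * f 1"
    by (intro eventually_conj eventually_gt_at_bot)
  then obtain l where l: "l < 0" "(\<Sum>n. f (Suc n) * exp l ^ n) < exp e * f 1"
    using eventually_happens'[OF trivial_limit_at_bot_linorder] by blast
  \<comment> \<open>As \<open>f 0 = 0\<close>, one factor \<open>exp l\<close> can be split off; the
    remaining series tends to \<open>f 1\<close> as \<open>l\<close> tends to -\<infinity>.\<close>
  have "Phi l = (\<Sum>n. f (Suc n) * exp l ^ Suc n)"
    unfolding Phi_powser
    using suminf_split_head[of "\<lambda>n. f n * exp l ^ n"] summable_Phi[of l] l f_0
    by (simp add: exp_of_nat2_mult)
  also have "\<dots> = exp l * (\<Sum>n. f (Suc n) * exp l ^ n)"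
    using summ[of "exp l"] l by (simp add: suminf_mult[symmetric] ac_simps)
  also have "\<dots> < exp l * (exp e * f 1)"
    using l by simp
  finally have "Lam l < ln (exp l * (exp e * f 1))"
    unfolding Lam_def using Phi_pos[of l] l f_1 by simp
  also have "\<dots> = l + e + ln (f 1)"
    using f_1 by (simp add: ln_mult)
  finally show ?thesis using l(1) by (intro exI[of _ l]) auto
qed

lemma legendre_one: "legendre 1 = ereal (- ln (f 1))"
  unfolding legendre_def
proof (rule antisym[OF SUP_least])
  fix l :: real assume l: "l \<in> {..0}"
  then have "ln (f 1 * exp l) \<le> Lam l"
    unfolding Lam_def using Phi_ge[of l] f_1 Phi_pos[of l] by simp
  then show "ereal (l * 1 - Lam l) \<le> ereal (- ln (f 1))"
    using f_1 by (simp add: ln_mult)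
next
  show "ereal (- ln (f 1)) \<le> (SUP l\<in>{..0}. ereal (l * 1 - Lam l))"
  proof (rule ereal_le_epsilon2)
    fix e :: real assume "0 < e"
    then obtain l where l: "l < 0" "l - Lam l > - ln (f 1) - e"
      using legendre_one_approx by blast
    then have "ereal (- ln (f 1)) \<le> ereal (l * 1 - Lam l) + ereal e" by simp
    also have "\<dots> \<le> (SUP l\<in>{..0}. ereal (l * 1 - Lam l)) + ereal e"
      using l by (intro add_right_mono SUP_upper) auto
    finally show "ereal (- ln (f 1)) \<le> (SUP l\<in>{..0}. ereal (l * 1 - Lam l)) + ereal e" .
  qed
qed

text \<open>As \<open>T \<ge> 1\<close>, \<open>Lam l \<le> l\<close>; so the supremum is at least
  that of \<open>- l * (1 - y)\<close> over \<open>l \<le> 0\<close>. The witness makes this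
  expression equal to \<open>\<bar>B\<bar>\<close>.\<close>

lemma legendre_below_one:
  assumes "y < 1"
  shows "legendre y = \<infinity>"
proof (rule ereal_top)
  fix B :: real
  define l where "l = - \<bar>B\<bar> / (1 - y)"
  have l: "l \<le> 0" using assms by (simp add: l_def divide_nonpos_pos)
  have "Lam l \<le> l"
    unfolding Lam_def using ln_mono[OF Phi_le[OF l] Phi_pos[OF l]] by simp
  moreover have "l * (1 - y) = - \<bar>B\<bar>"
    using assms by (simp add: l_def)
  then have "l * y - l = \<bar>B\<bar>"
    by (simp add: algebra_simps)
  ultimately have "ereal B \<le> ereal (l * y - Lam l)" by simp
  also have "\<dots> \<le> legendre y"
    unfolding legendre_def using l by (intro SUP_upper) auto
  finally show "ereal B \<le> legendre y" .
qed

end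

section \<open>Deviations of sums of waiting times\<close>

text \<open>With \<open>P = Phi z\<close> and \<open>Q = Phi l\<close>, a comparison of normalised
  transforms becomes the statement that a Chernoff factor under the law tilted by \<open>l\<close>
  is less than one.\<close>

lemma exp_tilt_less:
  fixes P Q :: real
  assumes "exp (- z * c) * P < exp (- l * c) * Q"
  shows "P * exp (- (z - l) * c) < Q"
proof -
  have eqs: "exp (- (z - l) * c) = exp (l * c) * exp (- z * c)" "exp (l * c) * exp (- l * c) = 1"
    by (simp_all add: exp_add[symmetric] algebra_simps)
  have "exp (l * c) * (exp (- z * c) * P) < exp (l * c) * (exp (- l * c) * Q)"
    using assms by simp
  then have "exp (l * c) * exp (- z * c) * P < exp (l * c) * exp (- l * c) * Q"
    by (simp only: mult.assoc)
  then show ?thesis by (simp only: eqs mult_1_left mult.commute[of P])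
qed

text \<open>\<open>A m n\<close> is the probability that the sum of \<open>m\<close> independent waiting times equals \<open>n\<close>.\<close>

locale waiting_time_sums = waiting_time +
  fixes A :: "nat \<Rightarrow> nat \<Rightarrow> real"
  assumes A_nonneg: "A m n \<ge> 0"
    and A_sums: "l < 0 \<Longrightarrow> (\<lambda>n. A m n * exp (l * real n)) sums (Phi l ^ m)"
begin

text \<open>The probability that \<open>m\<close> waiting times fit into time \<open>n\<close>,
  later identified with P(R_n >= m + 1).\<close>

definition mass :: "nat \<Rightarrow> nat \<Rightarrow> real" where
  "mass m n = (\<Sum>j\<le>n. A m j)"

lemma mass_chernoff:
  assumes "l < 0"
  shows "mass m n \<le> exp (- l * real n) * Phi l ^ m"
proof -
  have "mass m n * exp (l * real n) = (\<Sum>j\<le>n. A m j * exp (l * real n))"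
    by (simp add: mass_def sum_distrib_right)
  also have "\<dots> \<le> (\<Sum>j\<le>n. A m j * exp (l * real j))"
    using assms by (intro sum_mono mult_left_mono A_nonneg) simp
  also have "\<dots> \<le> Phi l ^ m"
    using A_sums[OF assms, of m] A_nonneg
    by (subst sums_unique[OF A_sums[OF assms]], intro sum_le_suminf) (auto simp: sums_iff)
  finally have "mass m n * exp (l * real n) * exp (- l * real n) \<le> Phi l ^ m * exp (- l * real n)"
    by (rule mult_right_mono) simp
  moreover have "mass m n * exp (l * real n) * exp (- l * real n) = mass m n"
    by (simp add: mult.assoc exp_add[symmetric])
  ultimately have "mass m n \<le> Phi l ^ m * exp (- l * real n)" by (simp only:)
  then show ?thesis by (simp only: mult.commute)
qed

text \<open>Change of measure with parameter \<open>l\<close>; the two deviation probabilities of the tilted law are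
  estimated by Chernoff bounds with the parameters \<open>z\<close> and \<open>x\<close>.\<close>

lemma mass_tilting:
  assumes "x < l" "l < z" "z < 0" "real m * c \<le> real n"
  shows "Phi l ^ m \<le> mass m n * exp (l * (real m * a))
     + (Phi z * exp (- (z - l) * c)) ^ m + (Phi x * exp ((l - x) * a)) ^ m"
proof -
  let ?u = "\<lambda>j. if j \<in> {..n} then A m j * exp (l * (real m * a)) else 0"
  let ?v = "\<lambda>j. A m j * exp (z * real j) * exp (- (z - l) * c) ^ m"
  let ?w = "\<lambda>j. A m j * exp (x * real j) * exp ((l - x) * a) ^ m"
  have sums: "(\<lambda>j. ?u j + ?v j + ?w j) sums
     (mass m n * exp (l * (real m * a)) + Phi z ^ m * exp (- (z - l) * c) ^ m
      + Phi x ^ m * exp ((l - x) * a) ^ m)"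
    unfolding mass_def sum_distrib_right
    by (intro sums_add sums_mult2 A_sums sums_If_finite_set) (use assms in auto)
  have "A m j * exp (l * real j) \<le> ?u j + ?v j + ?w j" for j
  proof -
    have bound: "exp (l * real j) \<le> (if j \<le> n then exp (l * (real m * a)) else 0)
        + exp (z * real j + real m * (- (z - l) * c)) + exp (x * real j + real m * ((l - x) * a))"
    proof -
      \<comment> \<open>Above \<open>n\<close> the summand is dominated through \<open>z\<close>,
        below \<open>m * a\<close> through \<open>x\<close>; in the window between them
        \<open>l < 0\<close> makes the left end the worst case.\<close>
      consider "n < j" | "j \<le> n" "real m * a \<le> real j" | "real j \<le> real m * a" by linarith
      then show ?thesis
      proof cases
        case 1
        then have "0 \<le> (z - l) * (real j - real m * c)"
          using assms by (intro mult_nonneg_nonneg) auto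
        then have "exp (l * real j) \<le> exp (z * real j + real m * (- (z - l) * c))"
          by (simp add: algebra_simps)
        then show ?thesis by (intro add_increasing2 add_increasing) auto
      next
        case 2
        then have "exp (l * real j) \<le> exp (l * (real m * a))"
          using assms by simp
        then show ?thesis using 2 by (intro add_increasing2) auto
      next
        case 3
        then have "0 \<le> (l - x) * (real m * a - real j)"
          using assms by (intro mult_nonneg_nonneg) auto
        then have "exp (l * real j) \<le> exp (x * real j + real m * ((l - x) * a))"
          by (simp add: algebra_simps)
        then show ?thesis by (intro add_increasing) auto
      qed
    qed
    show ?thesis
      using mult_left_mono[OF bound A_nonneg[of m j]]
      by (cases "j \<le> n") (simp_all only: exp_add exp_of_nat_mult distrib_left mult.assoc mem_Collect_eq atMost_iff if_True if_False mult_zero_right)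
  qed
  from sums_le[OF this A_sums sums] show ?thesis
    using assms by (simp add: power_mult_distrib)
qed

text \<open>Under the law tilted by \<open>l\<close> a waiting time has mean Lambda'(l). Taking
  \<open>l\<close> strictly between the roots for \<open>a\<close> and \<open>c\<close> puts this
  mean strictly between \<open>a\<close> and \<open>c\<close>, so both deviations of the sum are
  exponentially small, while \<open>a\<close> close to \<open>c\<close> keeps the loss in the window
  within \<open>e\<close>.\<close>

lemma mass_lower:
  assumes c: "1 < c" and lc: "lc < 0" "tilt c lc = 0"
    and roots: "\<And>a. 1 < a \<Longrightarrow> a < c \<Longrightarrow> \<exists>l<0. tilt a l = 0"
    and e: "e > 0"
  shows "\<forall>\<^sub>F m in sequentially. \<forall>n. real n \<ge> real m * c \<longrightarrow>
           mass m n \<ge> exp (- (real m * (lc * c - Lam lc + e)))"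
proof -
  define a0 where "a0 = (1 + c) / 2"
  have a0: "1 < a0" "a0 < c" using c by (auto simp: a0_def)
  from roots[OF this] obtain l0 where l0: "l0 < 0" "tilt a0 l0 = 0" by blast
  \<comment> \<open>The loss is \<open>l * (c - a)\<close>, but \<open>l\<close> depends on
    \<open>a\<close>. The root \<open>l0\<close> for the fixed level \<open>a0\<close> bounds
    \<open>l\<close> from below, so \<open>a\<close> can be chosen beforehand with
    \<open>- l0 * (c - a) \<le> e / 2\<close>.\<close>
  define a where "a = max a0 (c - e / (2 * (- l0)))"
  have "e / (2 * (- l0)) > 0" using e l0 by (intro divide_pos_pos) auto
  then have a: "1 < a" "a < c" "a0 \<le> a" "c - a \<le> e / (2 * (- l0))"
    using a0 by (auto simp: a_def)
  from roots[OF a(1,2)] obtain la where la: "la < 0" "tilt a la = 0" by blast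
  have "l0 \<le> la"
  proof (cases "a0 = a")
    case True
    then show ?thesis using tilt_root_unique[of a0 l0 la] a0 l0 la by auto
  next
    case False
    then show ?thesis using tilt_root_mono[of a0 a l0 la] a0 a l0 la by auto
  qed
  have "la < lc" using tilt_root_mono[of a c la lc] a la lc by auto
  define l where "l = (la + lc) / 2"
  have l: "la < l" "l < lc" "l < 0" "l0 \<le> l"
    using \<open>la < lc\<close> \<open>l0 \<le> la\<close> lc by (auto simp: l_def)
  have Phi: "Phi l > 0" "Phi la > 0" "Phi lc > 0" using Phi_pos l la lc by auto
  define r1 where "r1 = Phi lc * exp (- (lc - l) * c) / Phi l"
  define r2 where "r2 = Phi la * exp ((l - la) * a) / Phi l"
  have K1: "exp (- lc * c) * Phi lc < exp (- l * c) * Phi l"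
    using normalized_minimum[of lc l c] lc l c by auto
  have K2: "exp (- la * a) * Phi la < exp (- l * a) * Phi l"
    using normalized_minimum[of la l a] la l a by auto
  have r1: "0 < r1" "r1 < 1"
    using exp_tilt_less[OF K1] Phi by (simp_all add: r1_def)
  have r2: "0 < r2" "r2 < 1"
    using exp_tilt_less[OF K2] Phi by (simp_all add: r2_def)
  \<comment> \<open>The first two powers limit the deviations to half of the total mass; the third
    lets the remaining factor 1/2 be absorbed by the other half of \<open>e\<close>.\<close>
  have "(\<lambda>m. r1 ^ m + r2 ^ m + exp (- e / 2) ^ m) \<longlonglongrightarrow> 0 + 0 + 0"
    using r1 r2 e by (intro tendsto_add LIMSEQ_power_zero) auto
  then have "\<forall>\<^sub>F m in sequentially. r1 ^ m + r2 ^ m + exp (- e / 2) ^ m < 1 / 2"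
    by (rule order_tendstoD) simp
  then show ?thesis
  proof eventually_elim
    case (elim m)
    then have small: "r1 ^ m + r2 ^ m \<le> 1 / 2" "exp (- e / 2) ^ m \<le> 1 / 2"
      using r1 r2 zero_le_power[of r1 m] zero_le_power[of r2 m] zero_le_power[of "exp (- e / 2)" m]
      by (auto simp del: zero_le_power)
    show ?case
    proof (intro allI impI)
      fix n assume n: "real m * c \<le> real n"
      have "Phi l ^ m \<le> mass m n * exp (l * (real m * a)) + Phi l ^ m * (r1 ^ m + r2 ^ m)"
        using mass_tilting[OF l(1,2) lc(1) n, of a] Phi
        by (simp add: r1_def r2_def power_divide distrib_left)
      also have "\<dots> \<le> mass m n * exp (l * (real m * a)) + Phi l ^ m * (1 / 2)"
        using small Phi by (intro add_left_mono mult_left_mono) auto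
      finally have half: "Phi l ^ m * (1 / 2) \<le> mass m n * exp (l * (real m * a))" by simp
      have unit: "exp (- l * a) ^ m * exp (l * (real m * a)) = 1"
        by (simp add: exp_of_nat_mult[symmetric] exp_add[symmetric])
      from half have "exp (- l * a) ^ m * (Phi l ^ m * (1 / 2)) \<le> exp (- l * a) ^ m * (mass m n * exp (l * (real m * a)))"
        by (intro mult_left_mono) auto
      also have "\<dots> = mass m n"
        using unit by (simp only: mult.left_commute mult_1_right)
      finally have lower: "(exp (- l * a) * Phi l) ^ m * (1 / 2) \<le> mass m n"
        by (simp add: power_mult_distrib)
      have "- l0 * (c - a) \<le> - l0 * (e / (2 * (- l0)))"
        using a l0 by (intro mult_left_mono) auto
      also have "\<dots> = e / 2" using l0 by simp
      finally have "l0 * (c - a) \<ge> - e / 2" by simp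
      moreover have "l0 * (c - a) \<le> l * (c - a)"
        using l a by (intro mult_right_mono) auto
      ultimately have le2: "- e / 2 \<le> l * (c - a)" by linarith
      have "exp (- (lc * c - Lam lc) - e / 2) = exp (- lc * c) * Phi lc * exp (- e / 2)"
        using exp_Lam[of lc] lc by (simp add: exp_add[symmetric] flip: exp_Lam)
      also have "\<dots> \<le> exp (- l * c) * Phi l * exp (l * (c - a))"
        using le2 Phi by (intro mult_mono less_imp_le[OF K1]) auto
      also have "\<dots> = exp (- l * a) * Phi l"
        using l by (simp add: exp_add[symmetric] algebra_simps flip: exp_Lam)
      finally have "exp (- (lc * c - Lam lc) - e / 2) ^ m \<le> (exp (- l * a) * Phi l) ^ m"
        by (rule power_mono) simp
      then have "exp (- (lc * c - Lam lc) - e / 2) ^ m * exp (- e / 2) ^ m \<le> (exp (- l * a) * Phi l) ^ m * (1 / 2)"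
        using small Phi by (intro mult_mono) auto
      moreover have "exp (- (lc * c - Lam lc) - e / 2) ^ m * exp (- e / 2) ^ m = exp (- (real m * (lc * c - Lam lc + e)))"
        by (simp add: exp_of_nat_mult[symmetric] exp_add[symmetric] algebra_simps)
      ultimately show "exp (- (real m * (lc * c - Lam lc + e))) \<le> mass m n"
        using lower by linarith
    qed
  qed
qed

text \<open>The two bounds are hypotheses so that \<open>y < 1\<close>, with a root of
  \<open>tilt\<close>, and \<open>y = 1\<close>, with a limit as \<open>l\<close> tends to
  -\<infinity>, are treated at once.\<close>

lemma mass_ldp:
  assumes y: "0 < y" "y \<le> 1" and r: "r \<ge> 0"
    and upper: "\<And>e. e > 0 \<Longrightarrow> \<exists>l<0. l * (1 / y) - Lam l > r - e"
    and lower: "\<And>e. e > 0 \<Longrightarrow> \<forall>\<^sub>F m in sequentially. \<forall>n. real n \<ge> real m * (1 / y) \<longrightarrow>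
           mass m n \<ge> exp (- (real m * (r + e)))"
  shows "(\<lambda>n. ereal (1 / real n) * elog (mass (nat \<lceil>real n * y\<rceil> - 1) n)) \<longlonglongrightarrow> - (ereal y * ereal r)"
proof -
  \<comment> \<open>The record at time \<open>0\<close> is subtracted. The strict inequality
    \<open>real (m n) < real n * y\<close> makes \<open>n\<close> admissible in the lower bound for
    \<open>m n\<close> waiting times.\<close>
  define m where "m n = nat \<lceil>real n * y\<rceil> - 1" for n
  have m: "real (m n) < real n * y" "real n * y - 1 \<le> real (m n)" if "n > 0" for n
  proof -
    have "real n * y > 0" using that y by simp
    then have "\<lceil>real n * y\<rceil> \<ge> 1" by linarith
    then have "real (m n) = real_of_int \<lceil>real n * y\<rceil> - 1"
      by (simp add: m_def of_nat_diff nat_le_iff le_nat_iff)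
    then show "real (m n) < real n * y" "real n * y - 1 \<le> real (m n)" by linarith+
  qed
  have m_lim: "filterlim m at_top sequentially"
  proof -
    have "filterlim (\<lambda>n. y * real n + - 1) at_top sequentially"
      using filterlim_tendsto_add_at_top[OF tendsto_const[of "-1"] filterlim_tendsto_pos_mult_at_top[OF tendsto_const y(1) filterlim_real_sequentially]]
      by (simp add: add.commute)
    then have "filterlim (\<lambda>n. real (m n)) at_top sequentially"
      by (rule filterlim_at_top_mono) (auto intro!: eventually_sequentiallyI[of 1] m(2)[THEN order_trans[rotated]] simp: mult.commute)
    then show ?thesis by (simp add: filterlim_sequentially_iff_filterlim_real)
  qed
  have low: "\<forall>\<^sub>F n in sequentially. mass (m n) n \<ge> exp (- (real n * y * (r + e)))" if "e > 0" for e
  proof -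
    have "\<forall>\<^sub>F n in sequentially. \<forall>k. real k \<ge> real (m n) * (1 / y) \<longrightarrow> mass (m n) k \<ge> exp (- (real (m n) * (r + e)))"
      using m_lim lower[OF that] by (rule filterlim_iff[THEN iffD1, rule_format])
    moreover have "\<forall>\<^sub>F n in sequentially. n > 0" by (rule eventually_gt_at_top)
    ultimately show ?thesis
    proof eventually_elim
      case (elim n)
      have "real n \<ge> real (m n) * (1 / y)" using m[of n] elim y by (simp add: field_simps)
      then have "mass (m n) n \<ge> exp (- (real (m n) * (r + e)))" using elim by blast
      moreover have "real (m n) * (r + e) \<le> real n * y * (r + e)"
        using m[of n] elim r that by (intro mult_right_mono) auto
      ultimately show ?case by (smt (verit) exp_le_cancel_iff)
    qed
  qed
  \<comment> \<open>A positive mass rules out the value -\<infinity> of \<open>elog\<close>.\<close>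
  have pos: "\<forall>\<^sub>F n in sequentially. mass (m n) n > 0"
    using low[of 1] by (auto elim!: eventually_mono intro: less_le_trans[OF exp_gt_zero])
  have "(\<lambda>n. ln (mass (m n) n) / real n) \<longlonglongrightarrow> - (y * r)"
  proof (rule tendstoI)
    fix e :: real assume e: "e > 0"
    \<comment> \<open>An error \<open>d\<close> per record becomes \<open>y * d = e / 2\<close> per
      unit of time.\<close>
    define d where "d = e / (2 * y)"
    have d: "d > 0" "y * d = e / 2" using e y by (auto simp: d_def)
    obtain l where l: "l < 0" "l * (1 / y) - Lam l > r - d" using upper[OF d(1)] by blast
    have Lam_le: "Lam l \<le> 0" unfolding Lam_def using Phi_le_1[of l] Phi_pos[of l] l by simp
    \<comment> \<open>Replacing \<open>m n\<close> by \<open>real n * y - 1\<close> in the Chernoff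
      exponent costs only the constant \<open>- Lam l\<close>, which vanishes after division by
      \<open>n\<close>.\<close>
    have "(\<lambda>n. - Lam l / real n) \<longlonglongrightarrow> 0" by (rule lim_const_over_n)
    then have "\<forall>\<^sub>F n in sequentially. - Lam l / real n < e / 2"
      by (rule order_tendstoD) (use e in auto)
    moreover have "\<forall>\<^sub>F n in sequentially. n > 0" by (rule eventually_gt_at_top)
    ultimately show "\<forall>\<^sub>F n in sequentially. dist (ln (mass (m n) n) / real n) (- (y * r)) < e"
      using pos low[OF d(1)]
    proof eventually_elim
      case (elim n)
      have "ln (exp (- (real n * y * (r + d)))) \<le> ln (mass (m n) n)"
        using elim by (intro ln_mono) auto
      then have "- (real n * y * (r + d)) / real n \<le> ln (mass (m n) n) / real n"
        by (intro divide_right_mono) auto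
      moreover have "- (real n * y * (r + d)) / real n = - (y * r) - y * d"
        using \<open>n > 0\<close> by (simp add: field_simps)
      ultimately have 1: "- (y * r) - e / 2 \<le> ln (mass (m n) n) / real n"
        by (simp only: d(2))
      have "ln (mass (m n) n) \<le> ln (exp (- l * real n) * Phi l ^ m n)"
        using elim by (intro ln_mono mass_chernoff l) auto
      also have "\<dots> = - l * real n + real (m n) * Lam l"
        using Phi_pos[of l] l by (simp add: ln_mult ln_realpow Lam_def)
      also have "real (m n) * Lam l \<le> (real n * y - 1) * Lam l"
        using m(2)[of n] elim Lam_le by (intro mult_right_mono_neg) auto
      also have "- l * real n + (real n * y - 1) * Lam l = - (real n * y * (l * (1 / y) - Lam l)) - Lam l"
        using y by (simp add: field_simps)
      also have "\<dots> \<le> - (real n * y * (r - d)) - Lam l"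
        using l y by (intro diff_right_mono le_imp_neg_le mult_left_mono) auto
      finally have "ln (mass (m n) n) / real n \<le> (- (real n * y * (r - d)) - Lam l) / real n"
        by (intro divide_right_mono) auto
      also have "\<dots> = - (y * r) + e / 2 + (- Lam l / real n)"
        using elim d(2) by (simp add: field_simps)
      also have "\<dots> < - (y * r) + e" using \<open>- Lam l / real n < e / 2\<close> by linarith
      finally show ?case using 1 e by (simp add: dist_real_def abs_less_iff)
    qed
  qed
  then have "(\<lambda>n. ereal (ln (mass (m n) n) / real n)) \<longlonglongrightarrow> ereal (- (y * r))" by simp
  moreover have "\<forall>\<^sub>F n in sequentially. ereal (ln (mass (m n) n) / real n) = ereal (1 / real n) * elog (mass (m n) n)"
    using pos by (auto elim!: eventually_mono simp: elog_def)
  ultimately have "(\<lambda>n. ereal (1 / real n) * elog (mass (m n) n)) \<longlonglongrightarrow> ereal (- (y * r))"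
    by (rule Lim_transform_eventually)
  then show ?thesis by (simp add: m_def)
qed

text \<open>At level one, the event that all \<open>m\<close> waiting times equal one already has
  the right exponential order.\<close>

lemma mass_diag_lower:
  assumes "\<And>m. A m m \<ge> f 1 ^ m" "e > 0"
  shows "\<forall>\<^sub>F m in sequentially. \<forall>n. real n \<ge> real m * 1 \<longrightarrow> mass m n \<ge> exp (- (real m * (- ln (f 1) + e)))"
proof (intro always_eventually allI impI)
  fix m n :: nat assume "real n \<ge> real m * 1"
  then have "A m m \<le> mass m n" unfolding mass_def by (intro member_le_sum A_nonneg) auto
  moreover have "exp (- (real m * (- ln (f 1) + e))) \<le> exp (real m * ln (f 1))"
    using assms(2) by (simp add: algebra_simps)
  moreover have "exp (real m * ln (f 1)) = f 1 ^ m" using f_1 by (simp add: exp_of_nat_mult)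
  ultimately show "mass m n \<ge> exp (- (real m * (- ln (f 1) + e)))" using assms(1)[of m] by linarith
qed

end

section \<open>Renewal sequences and the Spitzer identity\<close>

text \<open>\<open>u n\<close> stands for the probability of a record at time \<open>n\<close>, and
  its limit \<open>q\<close> for the probability that the walk never becomes negative;
  \<open>q = 0\<close> is allowed and corresponds to an infinite mean.\<close>

locale renewal =
  fixes f u :: "nat \<Rightarrow> real" and q :: real
  assumes f_nonneg: "f n \<ge> 0"
    and f_0: "f 0 = 0"
    and f_sums: "f sums 1"
    and u_0: "u 0 = 1"
    and u_Suc: "u (Suc n) = (\<Sum>j\<le>n. u j * f (Suc n - j))"
    and u_ge: "q \<le> u n"
    and u_lim: "u \<longlonglongrightarrow> q"
    and u_le: "u n \<le> 1"
    and q_nonneg: "0 \<le> q"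
begin

definition tail :: "nat \<Rightarrow> real" where
  "tail n = 1 - (\<Sum>k\<le>n. f k)"

lemma tail_nonneg: "tail n \<ge> 0"
  unfolding tail_def using f_sums f_nonneg sum_le_suminf[of f "{..n}"] by (auto simp: sums_iff)

lemma tail_le_1: "tail n \<le> 1"
  unfolding tail_def using f_nonneg by (simp add: sum_nonneg)

lemma tail_0: "tail 0 = 1"
  by (simp add: tail_def f_0)

lemma tail_Suc: "tail (Suc n) = tail n - f (Suc n)"
  by (simp add: tail_def)

lemma tail_lim: "tail \<longlonglongrightarrow> 0"
  unfolding tail_def using tendsto_diff[OF tendsto_const[of 1] f_sums[unfolded sums_def_le]] by simp

text \<open>Exactly one \<open>j \<le> n\<close> is the last renewal up to time \<open>n\<close>. In
  the induction, passing from \<open>n\<close> to \<open>Suc n\<close> removes precisely the sum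
  that the renewal equation calls \<open>u (Suc n)\<close>.\<close>

lemma last_renewal: "(\<Sum>j\<le>n. u j * tail (n - j)) = 1"
proof (induction n)
  case 0
  show ?case by (simp add: u_0 tail_0)
next
  case (Suc n)
  have "(\<Sum>j\<le>n. u j * tail (Suc n - j)) = (\<Sum>j\<le>n. u j * tail (n - j) - u j * f (Suc n - j))"
    by (intro sum.cong) (auto simp: Suc_diff_le tail_Suc algebra_simps)
  then show ?case by (simp add: sum_subtractf Suc.IH u_Suc tail_0)
qed

lemma last_renewal': "(\<Sum>k\<le>n. tail k * u (n - k)) = 1"
  using last_renewal[of n] sum.nat_diff_reindex[of "\<lambda>j. u j * tail (n - j)" "Suc n"]
  by (simp add: lessThan_Suc_atMost mult.commute)

lemma summable_tail:
  assumes "q > 0"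
  shows "summable tail"
proof (rule summableI_nonneg_bounded[OF tail_nonneg])
  fix n
  have "q * (\<Sum>k<n. tail k) \<le> q * (\<Sum>k\<le>n. tail k)"
    using assms tail_nonneg by (intro mult_left_mono sum_mono2) auto
  also have "\<dots> = (\<Sum>k\<le>n. tail k * q)"
    by (simp add: sum_distrib_left mult.commute)
  also have "\<dots> \<le> (\<Sum>k\<le>n. tail k * u (n - k))"
    by (intro sum_mono mult_left_mono u_ge tail_nonneg)
  finally show "(\<Sum>k<n. tail k) \<le> 1 / q"
    using assms last_renewal'[of n] by (simp add: field_simps)
qed

text \<open>The limit is taken inside the last-renewal identity, with \<open>tail\<close> as
  summable majorant. Read backwards, \<open>q = 0\<close> forces the sum of \<open>tail\<close>,
  which is the mean, to diverge.\<close>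

lemma suminf_tail:
  assumes "summable tail"
  shows "q * (\<Sum>n. tail n) = 1"
proof -
  have "(\<lambda>n. \<Sum>k. if k \<le> n then tail k * u (n - k) else 0) \<longlonglongrightarrow> (\<Sum>k. tail k * q)"
  proof (rule tannerys_theorem[where M = tail, THEN conjunct2, THEN conjunct2])
    fix k
    have "(\<lambda>n. tail k * u (n - k)) \<longlonglongrightarrow> tail k * q"
      using LIMSEQ_offset[of "\<lambda>n. u (n - k)" k] u_lim by (intro tendsto_mult) auto
    then show "(\<lambda>n. if k \<le> n then tail k * u (n - k) else 0) \<longlonglongrightarrow> tail k * q"
      by (rule Lim_transform_eventually) (rule eventually_sequentiallyI[of k], simp)
  next
    have "norm (if k \<le> n then tail k * u (n - k) else 0) \<le> tail k" for k n
      using tail_nonneg[of k] u_le[of "n - k"] u_ge[of "n - k"] q_nonneg by (auto simp: abs_mult mult_left_le)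
    then show "\<forall>\<^sub>F (k, n) in at_top \<times>\<^sub>F sequentially. norm (if k \<le> n then tail k * u (n - k) else 0) \<le> tail k"
      by (intro always_eventually) auto
  qed (use assms in auto)
  moreover have "(\<Sum>k. if k \<le> n then tail k * u (n - k) else 0) = 1" for n
    using last_renewal'[of n] suminf_finite[of "{..n}" "\<lambda>k. if k \<le> n then tail k * u (n - k) else 0"] by simp
  ultimately have "(\<lambda>n::nat. 1) \<longlonglongrightarrow> (\<Sum>k. tail k * q)" by simp
  then have "1 = (\<Sum>k. tail k * q)" by (simp add: LIMSEQ_const_iff)
  then show ?thesis using suminf_mult[OF assms, of q] by (simp add: mult.commute)
qed

lemma mean_partial_sum: "(\<Sum>k\<le>n. real k * f k) = (\<Sum>j<n. tail j - tail n)"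
proof (induction n)
  case (Suc n)
  have "(\<Sum>j<Suc n. tail j - tail (Suc n)) = (\<Sum>j<n. tail j - tail n) + real (Suc n) * f (Suc n)"
    by (simp add: tail_Suc sum_subtractf sum.distrib algebra_simps)
  then show ?case using Suc by simp
qed simp

text \<open>Translates the certificate from partial sums of P(T > j) into partial sums of
  \<open>k * f k\<close>. With \<open>J\<close> fixed, the correction \<open>tail n\<close> in the
  summation by parts fades as \<open>n\<close> grows.\<close>

lemma mean_exceeds:
  assumes "y < (\<Sum>j<J. tail j)"
  shows "\<exists>K. y < (\<Sum>k<K. real k * f k)"
proof -
  have "(\<lambda>n. \<Sum>j<J. tail j - tail n) \<longlonglongrightarrow> (\<Sum>j<J. tail j - 0)"
    by (intro tendsto_intros tail_lim)
  then have "\<forall>\<^sub>F n in sequentially. y < (\<Sum>j<J. tail j - tail n)"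
    using assms by (intro order_tendstoD) auto
  then have "\<forall>\<^sub>F n in sequentially. J \<le> n \<and> y < (\<Sum>j<J. tail j - tail n)"
    by (intro eventually_conj eventually_ge_at_top)
  then obtain n where n: "J \<le> n" "y < (\<Sum>j<J. tail j - tail n)"
    using eventually_happens'[OF sequentially_bot] by blast
  have "decseq tail"
    by (rule decseq_SucI) (simp add: tail_Suc f_nonneg)
  then have "(\<Sum>j<J. tail j - tail n) \<le> (\<Sum>j<n. tail j - tail n)"
    using n by (intro sum_mono2) (auto simp: decseq_def)
  also have "\<dots> = (\<Sum>k<Suc n. real k * f k)"
    by (simp add: mean_partial_sum lessThan_Suc_atMost)
  finally show ?thesis using n by (intro exI[of _ "Suc n"]) simp
qed

end

section \<open>Power series with bounded coefficients and their behaviour at one\<close>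

lemma bounded_powser_summable:
  fixes c :: "nat \<Rightarrow> real"
  assumes "\<And>n. \<bar>c n\<bar> \<le> 1" "\<bar>s\<bar> < 1"
  shows "summable (\<lambda>n. norm (c n * s ^ n))"
proof (rule summable_comparison_test')
  show "summable (\<lambda>n. \<bar>s\<bar> ^ n)" using assms by (intro summable_geometric) auto
  show "norm (norm (c n * s ^ n)) \<le> \<bar>s\<bar> ^ n" for n
    using assms(1)[of n] by (simp add: abs_mult power_abs mult_left_le_one_le)
qed

lemma bounded_powser_deriv:
  fixes c :: "nat \<Rightarrow> real"
  assumes "\<And>n. \<bar>c n\<bar> \<le> 1" "\<bar>s\<bar> < 1"
  shows "((\<lambda>s. \<Sum>n. c n * s ^ n) has_real_derivative (\<Sum>n. diffs c n * s ^ n)) (at s)"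
proof (rule termdiffs_strong)
  show "summable (\<lambda>n. c n * ((1 + \<bar>s\<bar>) / 2) ^ n)"
    using bounded_powser_summable[of c "(1 + \<bar>s\<bar>) / 2", OF assms(1)] assms(2)
    by (auto intro: summable_norm_cancel)
qed (use assms in auto)

text \<open>A finite sum is continuous in \<open>s\<close>, so a bound uniform in
  \<open>s < 1\<close> survives at \<open>s = 1\<close>. For series with nonnegative terms this does
  the work of Abel's limit theorem.\<close>

lemma abel_bound:
  fixes c :: "nat \<Rightarrow> real"
  assumes "\<And>s. 0 < s \<Longrightarrow> s < 1 \<Longrightarrow> (\<Sum>n<N. c n * s ^ e n) \<le> B"
  shows "(\<Sum>n<N. c n) \<le> B"
proof -
  have "((\<lambda>s. \<Sum>n<N. c n * s ^ e n) \<longlongrightarrow> (\<Sum>n<N. c n * 1 ^ e n)) (at_left 1)"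
    by (intro tendsto_intros)
  moreover have "\<forall>\<^sub>F s in at_left 1. (\<Sum>n<N. c n * s ^ e n) \<le> B"
    using assms by (intro eventually_at_leftI[of 0]) auto
  ultimately have "(\<Sum>n<N. c n * 1 ^ e n) \<le> B"
    by (rule tendsto_upperbound) simp
  then show ?thesis by simp
qed

text \<open>For \<open>n > 0\<close>, \<open>w n\<close> is the probability that the walk is nonnegative at time \<open>n\<close>; the equation forces
  \<open>w 0 = 0\<close>.\<close>

locale spitzer = renewal +
  fixes w :: "nat \<Rightarrow> real"
  assumes w_eq: "w n = (\<Sum>j\<le>n. u j * (real (n - j) * f (n - j)))"
    and w_nonneg: "w n \<ge> 0" and w_le: "w n \<le> 1"
begin

text \<open>In formal power series this is \<open>T' = T * R\<close>. It follows from
  \<open>T * U = 1 / (1 - X)\<close>, from \<open>(1 - X) * T = 1 - F\<close> together with its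
  derivative, and from \<open>R = 1 / (1 - X) - F' * U\<close>, which is the rotation
  identity.\<close>

lemma tail_recursion: "real (Suc n) * tail (Suc n) = (\<Sum>j\<le>n. tail j * (1 - w (Suc (n - j))))"
proof -
  define G where "G = Abs_fps (\<lambda>_::nat. 1 :: real)"
  have G: "G * (1 - fps_X) = 1"
  proof (rule fps_ext)
    fix n show "fps_nth (G * (1 - fps_X)) n = fps_nth 1 n"
      by (cases n) (simp_all add: right_diff_distrib G_def)
  qed
  let ?T = "Abs_fps tail" and ?F = "Abs_fps f" and ?U = "Abs_fps u" and ?R = "Abs_fps (\<lambda>n. 1 - w (Suc n))"
  have TU: "?T * ?U = G"
    by (rule fps_ext) (use last_renewal' in \<open>simp add: fps_mult_nth G_def atLeast0AtMost\<close>)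
  have T: "(1 - fps_X) * ?T = 1 - ?F"
  proof (rule fps_ext)
    fix n show "fps_nth ((1 - fps_X) * ?T) n = fps_nth (1 - ?F) n"
      by (cases n) (auto simp: left_diff_distrib tail_0 tail_Suc f_0)
  qed
  have R: "?R = G - fps_deriv ?F * ?U"
  proof (rule fps_ext)
    fix n
    have "w (Suc n) = (\<Sum>j\<le>Suc n. real j * f j * u (Suc n - j))"
      using w_eq[of "Suc n"] sum.nat_diff_reindex[of "\<lambda>j. u j * (real (Suc n - j) * f (Suc n - j))" "Suc (Suc n)"]
      by (simp add: lessThan_Suc_atMost mult_ac del: of_nat_Suc sum.atMost_Suc)
    also have "\<dots> = (\<Sum>j\<le>n. real (Suc j) * f (Suc j) * u (n - j))"
      by (subst sum.atMost_Suc_shift) simp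
    finally show "fps_nth ?R n = fps_nth (G - fps_deriv ?F * ?U) n"
      by (simp add: fps_mult_nth G_def atLeast0AtMost)
  qed
  have dT: "(1 - fps_X) * fps_deriv ?T = ?T - fps_deriv ?F"
    using arg_cong[OF T, of fps_deriv] by (simp add: algebra_simps)
  have "(1 - fps_X) * (?T * ?R) = (1 - fps_X) * fps_deriv ?T"
  proof -
    have "(1 - fps_X) * (?T * ?R) = (G * (1 - fps_X)) * ?T - (1 - fps_X) * fps_deriv ?F * (?T * ?U)"
      by (simp add: R algebra_simps)
    also have "(1 - fps_X) * fps_deriv ?F * (?T * ?U) = fps_deriv ?F * (G * (1 - fps_X))"
      unfolding TU by (simp only: mult_ac)
    finally show ?thesis unfolding G dT by simp
  qed
  then have "G * (1 - fps_X) * (?T * ?R) = G * (1 - fps_X) * fps_deriv ?T"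
    by (simp only: mult.assoc)
  then have "?T * ?R = fps_deriv ?T"
    unfolding G by simp
  then have "fps_nth (?T * ?R) n = fps_nth (fps_deriv ?T) n" by simp
  then show ?thesis by (simp add: fps_mult_nth atLeast0AtMost)
qed

text \<open>The recursion is the differential equation \<open>T' = T * r\<close> with
  \<open>T 0 = 1\<close>; hence \<open>T\<close> times the exponential of minus a primitive of
  \<open>r\<close> is constant on \<open>[0, s]\<close>.\<close>

lemma tail_powser_exp:
  assumes "0 \<le> s" "s < 1"
  shows "(\<Sum>n. tail n * s ^ n) = exp (\<Sum>n. (1 - w (Suc n)) / real (Suc n) * s ^ Suc n)"
proof -
  \<comment> \<open>Padding with \<open>c 0 = 0\<close> gives a primitive that vanishes at the
    origin and satisfies \<open>diffs c n = 1 - w (Suc n)\<close>.\<close>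
  define c where "c n = (case n of 0 \<Rightarrow> 0 | Suc k \<Rightarrow> (1 - w (Suc k)) / real (Suc k))" for n
  have c: "\<bar>c n\<bar> \<le> 1" for n
  proof (cases n)
    case (Suc k)
    have "0 \<le> 1 - w (Suc k)" "1 - w (Suc k) \<le> 1" using w_nonneg w_le by auto
    then show ?thesis by (simp add: c_def Suc field_simps)
  qed (simp add: c_def)
  have tl: "\<bar>tail n\<bar> \<le> 1" for n using tail_nonneg[of n] tail_le_1[of n] by simp
  have rh: "\<bar>1 - w (Suc n)\<bar> \<le> 1" for n using w_nonneg[of "Suc n"] w_le[of "Suc n"] by simp
  let ?T = "\<lambda>s. \<Sum>n. tail n * s ^ n" and ?P = "\<lambda>s. \<Sum>n. c n * s ^ n"
  let ?r = "\<lambda>s. \<Sum>n. (1 - w (Suc n)) * s ^ n"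
  have dT: "(?T has_real_derivative ?T x * ?r x) (at x)" if "\<bar>x\<bar> < 1" for x
  proof -
    have "(\<lambda>n. \<Sum>j\<le>n. (tail j * x ^ j) * ((1 - w (Suc (n - j))) * x ^ (n - j))) sums (?T x * ?r x)"
      by (rule Cauchy_product_sums[OF bounded_powser_summable[OF tl that] bounded_powser_summable[OF rh that]])
    moreover have "(\<Sum>j\<le>n. (tail j * x ^ j) * ((1 - w (Suc (n - j))) * x ^ (n - j))) = diffs tail n * x ^ n" for n
      unfolding diffs_def tail_recursion sum_distrib_right
      by (intro sum.cong) (auto simp: power_add[symmetric])
    ultimately have "?T x * ?r x = (\<Sum>n. diffs tail n * x ^ n)" by (simp add: sums_iff)
    then show ?thesis using bounded_powser_deriv[OF tl that] by simp
  qed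
  have dP: "(?P has_real_derivative ?r x) (at x)" if "\<bar>x\<bar> < 1" for x
  proof -
    have "diffs c n = 1 - w (Suc n)" for n by (simp add: diffs_def c_def)
    then show ?thesis using bounded_powser_deriv[of c x, OF c that] by simp
  qed
  define E where "E x = ?T x * exp (- ?P x)" for x
  have d0: "(E has_real_derivative 0) (at x within {0..s})" if "x \<in> {0..s}" for x
  proof -
    have x: "\<bar>x\<bar> < 1" using that assms by simp
    have "(E has_real_derivative 0) (at x)"
      unfolding E_def by (rule derivative_eq_intros dT[OF x] dP[OF x] refl)+ simp
    then show ?thesis by (rule has_field_derivative_at_within)
  qed
  have "\<exists>k. \<forall>x\<in>{0..s}. E x = k"
    by (rule has_field_derivative_zero_constant[OF _ d0]) simp_all
  then obtain k where "\<forall>x\<in>{0..s}. E x = k" ..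
  then have "E s = E 0" using assms by simp
  then have "?T s * exp (- ?P s) = ?T 0 * exp (- ?P 0)"
    by (simp only: E_def)
  also have "\<dots> = 1" using tail_0 by (simp add: c_def)
  finally have "?T s = exp (?P s)" by (simp add: exp_minus field_simps)
  also have "?P s = (\<Sum>n. c (Suc n) * s ^ Suc n)"
    using suminf_split_head[of "\<lambda>n. c n * s ^ n"] bounded_powser_summable[OF c, of s] assms
    by (simp add: c_def summable_norm_cancel)
  finally show ?thesis by (simp add: c_def)
qed

text \<open>The identity for \<open>s < 1\<close> is carried to \<open>s = 1\<close> by one
  inequality in each direction, each for partial sums; all terms are nonnegative, so the full series
  dominate uniformly in \<open>s\<close>.\<close>

lemma spitzer_formula:
  assumes "summable tail"
  shows "summable (\<lambda>n. (1 - w (Suc n)) / real (Suc n))"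
    and "(\<Sum>n. tail n) = exp (\<Sum>n. (1 - w (Suc n)) / real (Suc n))"
proof -
  let ?c = "\<lambda>n. (1 - w (Suc n)) / real (Suc n)"
  have c_nonneg: "?c n \<ge> 0" for n using w_le by simp
  have c_pow: "0 \<le> ?c n * s ^ Suc n" if "0 < s" for s n
    using that by (intro mult_nonneg_nonneg c_nonneg) simp
  have c_le: "\<bar>?c n\<bar> \<le> 1" for n
    using w_le[of "Suc n"] w_nonneg[of "Suc n"] by (simp add: field_simps)
  have T_pos: "(\<Sum>n. tail n) > 0"
    using assms tail_nonneg tail_0 by (intro suminf_pos2[of _ 0]) auto
  have sumc: "summable (\<lambda>n. ?c n * s ^ Suc n)" if "0 < s" "s < 1" for s
    using summable_mult[OF summable_norm_cancel[OF bounded_powser_summable[of ?c s, OF c_le]], of s] that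
    by (simp add: mult_ac)
  have partial: "(\<Sum>n<N. ?c n) \<le> ln (\<Sum>n. tail n)" for N
  proof (rule abel_bound[where e = Suc])
    fix s :: real assume s: "0 < s" "s < 1"
    have "exp (\<Sum>n<N. ?c n * s ^ Suc n) \<le> exp (\<Sum>n. ?c n * s ^ Suc n)"
      using s by (subst exp_le_cancel_iff, intro sum_le_suminf sumc c_pow) auto
    also have "\<dots> = (\<Sum>n. tail n * s ^ n)"
      using tail_powser_exp[of s] s by simp
    also have "\<dots> \<le> (\<Sum>n. tail n)"
      using s tail_nonneg tail_le_1 power_le_one[of s] assms
      by (intro suminf_le summable_norm_cancel[OF bounded_powser_summable]) (auto simp: mult_left_le)
    finally show "(\<Sum>n<N. ?c n * s ^ Suc n) \<le> ln (\<Sum>n. tail n)"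
      using T_pos by (simp add: ln_ge_iff)
  qed
  show sum: "summable ?c"
    by (rule summableI_nonneg_bounded[OF c_nonneg partial])
  have "suminf ?c \<le> ln (\<Sum>n. tail n)"
    using sum partial by (intro suminf_le_const) auto
  then have "exp (suminf ?c) \<le> (\<Sum>n. tail n)" using T_pos by (simp add: ln_ge_iff)
  moreover have "(\<Sum>n<N. tail n) \<le> exp (suminf ?c)" for N
  proof (rule abel_bound[where e = id])
    fix s :: real assume s: "0 < s" "s < 1"
    have "(\<Sum>n<N. tail n * s ^ id n) \<le> (\<Sum>n. tail n * s ^ n)"
      using s tail_nonneg tail_le_1
      by (simp, intro sum_le_suminf summable_norm_cancel[OF bounded_powser_summable]) auto
    also have "\<dots> = exp (\<Sum>n. ?c n * s ^ Suc n)"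
      using tail_powser_exp[of s] s by simp
    also have "\<dots> \<le> exp (suminf ?c)"
      using s by (subst exp_le_cancel_iff, intro suminf_le sumc sum mult_left_le c_nonneg power_le_one) auto
    finally show "(\<Sum>n<N. tail n * s ^ id n) \<le> exp (suminf ?c)" .
  qed
  then have "(\<Sum>n. tail n) \<le> exp (suminf ?c)"
    using assms by (intro suminf_le_const) auto
  ultimately show "(\<Sum>n. tail n) = exp (suminf ?c)" by simp
qed

end

section \<open>Records of deterministic paths\<close>

text \<open>\<open>x i\<close> is the increment between the times \<open>i\<close> and
  \<open>i + 1\<close>. Counting steps from zero lets shifts and permutations of an initial block
  act on the index set without offset.\<close>

definition psum :: "(nat \<Rightarrow> real) \<Rightarrow> nat \<Rightarrow> real" where
  "psum x n = (\<Sum>i<n. x i)"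

definition drop_steps :: "nat \<Rightarrow> (nat \<Rightarrow> real) \<Rightarrow> nat \<Rightarrow> real" where
  "drop_steps k x = (\<lambda>i. x (i + k))"

definition is_record :: "(nat \<Rightarrow> real) \<Rightarrow> nat \<Rightarrow> bool" where
  "is_record x n \<longleftrightarrow> (\<forall>k\<le>n. psum x k \<le> psum x n)"

text \<open>As long as all later partial sums are negative the running maximum is the initial value
  \<open>0\<close>, so the first weak record is the first return to the nonnegative
  half-line.\<close>

definition first_record :: "(nat \<Rightarrow> real) \<Rightarrow> nat \<Rightarrow> bool" where
  "first_record x n \<longleftrightarrow> 0 < n \<and> 0 \<le> psum x n \<and> (\<forall>k\<in>{1..<n}. psum x k < 0)"

text \<open>The record at time \<open>0\<close> is not counted.\<close>

definition record_count :: "(nat \<Rightarrow> real) \<Rightarrow> nat \<Rightarrow> nat" where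
  "record_count x n = card {k\<in>{1..n}. is_record x k}"

lemma psum_0 [simp]: "psum x 0 = 0"
  by (simp add: psum_def)

lemma psum_add: "psum x (k + n) = psum x k + psum (drop_steps k x) n"
  unfolding psum_def drop_steps_def
  by (induction n) (simp_all add: add.commute)

lemma drop_steps_0 [simp]: "drop_steps 0 x = x"
  by (simp add: drop_steps_def)

lemma drop_steps_drop_steps [simp]: "drop_steps i (drop_steps k x) = drop_steps (i + k) x"
  by (simp add: drop_steps_def add.assoc)

lemma is_record_0 [simp]: "is_record x 0"
  by (simp add: is_record_def)

lemma is_record_nonneg: "is_record x n \<Longrightarrow> 0 \<le> psum x n"
  unfolding is_record_def using psum_0[of x] by (metis le0)

lemma record_count_0 [simp]: "record_count x 0 = 0"
  by (simp add: record_count_def)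

lemma record_count_Suc:
  "record_count x (Suc n) = record_count x n + (if is_record x (Suc n) then 1 else 0)"
proof -
  have "{k\<in>{1..Suc n}. is_record x k} = {k\<in>{1..n}. is_record x k} \<union> (if is_record x (Suc n) then {Suc n} else {})"
    by (auto simp: le_Suc_eq)
  then show ?thesis by (simp add: record_count_def)
qed

lemma record_count_sum: "record_count x n = (\<Sum>k=1..n. if is_record x k then 1 else 0)"
  by (induction n) (auto simp: record_count_Suc)

lemma record_count_le: "record_count x n \<le> n"
  by (induction n) (auto simp: record_count_Suc)

lemma record_count_mono: "i \<le> n \<Longrightarrow> record_count x i \<le> record_count x n"
  by (rule lift_Suc_mono_le) (auto simp: record_count_Suc)

lemma record_count_strict: "i < n \<Longrightarrow> is_record x n \<Longrightarrow> record_count x i < record_count x n"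
  using record_count_mono[of i "n - 1" x] record_count_Suc[of x "n - 1"] by (cases n) auto

text \<open>The witness is the \<open>m\<close>-th record time, with time \<open>0\<close> serving
  for \<open>m = 0\<close>. Since record times with a given count are unique, it turns the tail
  event into a disjoint union.\<close>

lemma record_count_ge_iff:
  "m \<le> record_count x n \<longleftrightarrow> (\<exists>j\<in>{..n}. is_record x j \<and> record_count x j = m)"
proof
  show "m \<le> record_count x n \<Longrightarrow> \<exists>j\<in>{..n}. is_record x j \<and> record_count x j = m"
  proof (induction n)
    case (Suc n)
    show ?case
    proof (cases "m \<le> record_count x n")
      case True
      then show ?thesis using Suc.IH by fastforce
    next
      case False
      then have "is_record x (Suc n) \<and> record_count x (Suc n) = m"
        using Suc.prems by (auto simp: record_count_Suc split: if_splits)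
      then show ?thesis by blast
    qed
  qed simp
qed (auto intro: record_count_mono)

lemma first_record_unique: "first_record x j \<Longrightarrow> first_record x k \<Longrightarrow> j = k"
proof -
  have "\<not> j < k" if "first_record x j" "first_record x k" for j k
  proof
    assume "j < k"
    then have "psum x j < 0" using that by (simp add: first_record_def)
    then show False using that by (simp add: first_record_def)
  qed
  then show "first_record x j \<Longrightarrow> first_record x k \<Longrightarrow> j = k"
    by (meson linorder_neqE_nat)
qed

lemma first_record_exists:
  assumes "n > 0" "psum x n \<ge> 0"
  shows "\<exists>k\<in>{1..n}. first_record x k"
proof -
  let ?P = "\<lambda>k. 0 < k \<and> psum x k \<ge> 0"
  have "?P (LEAST k. ?P k)" "(LEAST k. ?P k) \<le> n"
    using assms by (auto intro: LeastI2[of ?P n] Least_le)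
  moreover have "\<not> ?P j" if "j < (LEAST k. ?P k)" for j
    using that by (rule not_less_Least)
  ultimately show ?thesis
    by (intro bexI[of _ "LEAST k. ?P k"]) (force simp: first_record_def)+
qed

lemma first_record_not_before:
  assumes "first_record x k" "0 < j" "j < k"
  shows "\<not> is_record x j"
proof
  assume "is_record x j"
  then have "0 \<le> psum x j" by (rule is_record_nonneg)
  moreover have "psum x j < 0" using assms by (simp add: first_record_def)
  ultimately show False by simp
qed

text \<open>Up to time \<open>k\<close> the path never exceeds its value at \<open>k\<close>, so for
  a record at \<open>k + n\<close> only the values from \<open>k\<close> on compete.\<close>

lemma is_record_after:
  assumes "first_record x k"
  shows "is_record x (k + n) \<longleftrightarrow> is_record (drop_steps k x) n"
proof
  assume r: "is_record x (k + n)"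
  show "is_record (drop_steps k x) n"
    unfolding is_record_def
  proof (intro allI impI)
    fix j assume "j \<le> n"
    then have "psum x (k + j) \<le> psum x (k + n)" using r by (simp add: is_record_def)
    then show "psum (drop_steps k x) j \<le> psum (drop_steps k x) n" by (simp add: psum_add)
  qed
next
  assume r: "is_record (drop_steps k x) n"
  have k: "0 \<le> psum x k" using assms by (simp add: first_record_def)
  have n: "0 \<le> psum (drop_steps k x) n" using r by (rule is_record_nonneg)
  show "is_record x (k + n)"
    unfolding is_record_def
  proof (intro allI impI)
    fix j assume j: "j \<le> k + n"
    show "psum x j \<le> psum x (k + n)"
    proof (cases "j < k")
      case True
      then have "psum x j \<le> 0"
        using assms by (cases "j = 0") (auto simp: first_record_def less_imp_le)
      then show ?thesis using k n by (simp add: psum_add)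
    next
      case False
      then obtain i where "j = k + i" using le_Suc_ex not_less by blast
      then show ?thesis using r j by (simp add: psum_add is_record_def)
    qed
  qed
qed

lemma record_count_after:
  assumes "first_record x k"
  shows "record_count x (k + n) = Suc (record_count (drop_steps k x) n)"
proof (induction n)
  case 0
  have "{j\<in>{1..k}. is_record x j} = {k}"
    using assms first_record_not_before[OF assms] is_record_after[OF assms, of 0]
    by (auto simp: first_record_def le_less)
  then show ?case by (simp add: record_count_def)
next
  case (Suc n)
  then show ?case
    using is_record_after[OF assms, of "Suc n"] by (simp add: record_count_Suc)
qed

text \<open>\<open>j\<close> is the time left after the first record, as required by the convolution
  of the laws.\<close>

lemma record_split_first:
  assumes "n > 0"
  shows "is_record x n \<and> record_count x n = Suc m \<longleftrightarrow>
    (\<exists>j\<in>{..<n}. first_record x (n - j) \<and> is_record (drop_steps (n - j) x) j \<and> record_count (drop_steps (n - j) x) j = m)"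
    (is "?L \<longleftrightarrow> ?R")
proof
  assume L: ?L
  then have "psum x n \<ge> 0" by (auto dest: is_record_nonneg)
  then obtain k where k: "k \<in> {1..n}" "first_record x k" using first_record_exists assms by blast
  then show ?R
    using L is_record_after[OF k(2), of "n - k"] record_count_after[OF k(2), of "n - k"]
    by (intro bexI[of _ "n - k"]) auto
next
  assume ?R
  then obtain j where j: "j < n" "first_record x (n - j)" "is_record (drop_steps (n - j) x) j"
    "record_count (drop_steps (n - j) x) j = m" by auto
  then show ?L
    using is_record_after[OF j(2), of j] record_count_after[OF j(2), of j] by simp
qed

text \<open>Negativity up to time \<open>i\<close> means that the first record comes later than
  \<open>i\<close>. The case \<open>i = 0\<close> gives the renewal equation, the case
  \<open>i = n - p\<close> the rotation identity.\<close>

lemma is_record_split_first: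
  assumes "i < n"
  shows "is_record x n \<and> (\<forall>k\<in>{1..i}. psum x k < 0) \<longleftrightarrow>
    (\<exists>j\<in>{..<n - i}. first_record x (n - j) \<and> is_record (drop_steps (n - j) x) j)"
    (is "?L \<longleftrightarrow> ?R")
proof
  assume L: ?L
  then have "psum x n \<ge> 0" by (auto dest: is_record_nonneg)
  then obtain k where k: "k \<in> {1..n}" "first_record x k" using first_record_exists assms by (metis gr_zeroI not_less_zero)
  have "k \<notin> {1..i}" using L k(2) unfolding first_record_def by (meson not_less)
  then show ?R
    using L k is_record_after[OF k(2), of "n - k"]
    by (intro bexI[of _ "n - k"]) auto
next
  assume ?R
  then obtain j where j: "j < n - i" "first_record x (n - j)" "is_record (drop_steps (n - j) x) j" by auto
  then show ?L
    using is_record_after[OF j(2), of j] by (auto simp: first_record_def)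
qed

text \<open>The reversed path has the partial sums \<open>S_n - S_(n - k)\<close>; the last of them
  is maximal iff every \<open>S_(n - k)\<close> is nonnegative. Fixing the indices from
  \<open>n\<close> on makes \<sigma> injective on all of \<open>nat\<close>.\<close>

lemma is_record_rev:
  assumes "\<sigma> = (\<lambda>i. if i < n then n - 1 - i else i)"
  shows "is_record (x \<circ> \<sigma>) n \<longleftrightarrow> (\<forall>k\<le>n. 0 \<le> psum x k)"
proof -
  have *: "psum (x \<circ> \<sigma>) k = psum x n - psum x (n - k)" if "k \<le> n" for k
    using that
  proof (induction k)
    case (Suc k)
    have "psum x (Suc (n - Suc k)) = psum x (n - Suc k) + x (n - Suc k)" by (simp add: psum_def)
    moreover have "Suc (n - Suc k) = n - k" using Suc.prems by simp
    ultimately show ?case using Suc assms by (simp add: psum_def)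
  qed (simp add: psum_def)
  have "is_record (x \<circ> \<sigma>) n \<longleftrightarrow> (\<forall>k\<le>n. 0 \<le> psum x (n - k))"
    unfolding is_record_def using * by auto
  also have "\<dots> \<longleftrightarrow> (\<forall>k\<le>n. 0 \<le> psum x k)"
    by (metis diff_diff_cancel diff_le_self)
  finally show ?thesis .
qed

text \<open>The cyclic rotation that starts the path at the last maximum \<open>p\<close> over the times \<open>1, \<dots>, n\<close>.\<close>

lemma is_record_rotate:
  assumes p: "p \<in> {1..n}" and \<sigma>: "\<sigma> = (\<lambda>a. if a < n - p then p + a else if a < n then a - (n - p) else a)"
  shows "is_record (x \<circ> \<sigma>) n \<and> (\<forall>k\<in>{1..n - p}. psum (x \<circ> \<sigma>) k < 0) \<longleftrightarrow>
    0 \<le> psum x n \<and> (\<forall>m\<in>{1..n}. psum x m \<le> psum x p \<and> (p < m \<longrightarrow> psum x m < psum x p))"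
    (is "?L \<longleftrightarrow> ?R")
proof -
  \<comment> \<open>Up to time \<open>n - p\<close> the rotated path is the old one seen from
    \<open>p\<close>; after that it is the initial piece of the old one, raised by
    \<open>S_n - S_p\<close>.\<close>
  have 1: "psum (x \<circ> \<sigma>) k = psum x (p + k) - psum x p" if "k \<le> n - p" for k
    using that
  proof (induction k)
    case (Suc k)
    then show ?case using \<sigma> by (simp add: psum_def)
  qed (simp add: psum_def)
  have 2: "psum (x \<circ> \<sigma>) (n - p + m) = psum x n - psum x p + psum x m" if "m \<le> p" for m
    using that
  proof (induction m)
    case 0
    then show ?case using 1[of "n - p"] p by (simp del: comp_apply)
  next
    case (Suc m)
    have "\<sigma> (n - p + m) = m" using Suc.prems p \<sigma> by auto
    then show ?case using Suc by (simp add: psum_def)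
  qed
  have n: "psum (x \<circ> \<sigma>) n = psum x n" using 2[of p] p by simp
  show ?thesis
  proof
    assume L: ?L
    have "0 \<le> psum x n" using L n is_record_nonneg[of "x \<circ> \<sigma>" n] by simp
    moreover have "psum x m < psum x p" if "p < m" "m \<le> n" for m
    proof -
      have "m - p \<in> {1..n - p}" using that by auto
      then have "psum (x \<circ> \<sigma>) (m - p) < 0" using L by blast
      then show ?thesis using 1[of "m - p"] that by simp
    qed
    moreover have "psum x m \<le> psum x p" if "m \<le> p" for m
    proof -
      have "psum (x \<circ> \<sigma>) (n - p + m) \<le> psum x n"
        using L n p that unfolding is_record_def by auto
      then show ?thesis using 2[OF that] by simp
    qed
    ultimately show ?R by (metis atLeastAtMost_iff linorder_not_le nless_le psum_0)
  next
    assume R: ?R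
    have neg: "\<forall>k\<in>{1..n - p}. psum (x \<circ> \<sigma>) k < 0"
      using R p by (auto simp: 1)
    have "psum (x \<circ> \<sigma>) k \<le> psum (x \<circ> \<sigma>) n" if "k \<le> n" for k
    proof (cases "k \<le> n - p")
      case True
      then have "k = 0 \<or> k \<in> {1..n - p}" by auto
      then have "psum (x \<circ> \<sigma>) k \<le> 0" using neg less_imp_le psum_0 order_refl by metis
      then show ?thesis using R n by linarith
    next
      case False
      then have "k - (n - p) \<in> {1..n}" using that p by auto
      then have "psum x (k - (n - p)) \<le> psum x p" using R by blast
      moreover have "psum (x \<circ> \<sigma>) k = psum x n - psum x p + psum x (k - (n - p))"
        using 2[of "k - (n - p)"] False p that by auto
      ultimately show ?thesis using n by simp
    qed
    then show ?L using neg by (simp add: is_record_def)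
  qed
qed

text \<open>Choosing the last maximum makes \<open>p\<close> unique, so that the paths with
  \<open>S_n \<ge> 0\<close> are partitioned according to \<open>p\<close>.\<close>

lemma last_argmax_exists:
  fixes S :: "nat \<Rightarrow> real"
  assumes "n > 0"
  shows "\<exists>p\<in>{1..n}. \<forall>m\<in>{1..n}. S m \<le> S p \<and> (p < m \<longrightarrow> S m < S p)"
proof -
  let ?P = "\<lambda>p. p \<in> {1..n} \<and> (\<forall>m\<in>{1..n}. S m \<le> S p)"
  have "Max (S ` {1..n}) \<in> S ` {1..n}" using assms by (intro Max_in) auto
  then obtain p0 where "p0 \<in> {1..n}" "Max (S ` {1..n}) = S p0" by auto
  then have "?P p0" by (metis Max_ge finite_atLeastAtMost finite_imageI imageI)
  then have P: "?P (Greatest ?P)" by (rule GreatestI_nat[of ?P _ n]) auto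
  moreover have "S m < S (Greatest ?P)" if "m \<in> {1..n}" "Greatest ?P < m" for m
  proof (rule ccontr)
    assume "\<not> ?thesis"
    then have "?P m" using P that by force
    then have "m \<le> Greatest ?P" by (rule Greatest_le_nat[of ?P _ n]) auto
    then show False using that by simp
  qed
  ultimately show ?thesis by blast
qed

text \<open>A record of the whole path after time \<open>k\<close> is a record of the shifted path;
  the converse fails when the path at \<open>k\<close> is below its earlier maximum.\<close>

lemma record_count_subadd: "record_count x (k + n) \<le> record_count x k + record_count (drop_steps k x) n"
proof (induction n)
  case (Suc n)
  have "is_record (drop_steps k x) (Suc n)" if r: "is_record x (k + Suc n)"
    unfolding is_record_def
  proof (intro allI impI)
    fix j assume "j \<le> Suc n"
    then have "psum x (k + j) \<le> psum x (k + Suc n)" using r by (simp add: is_record_def)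
    then show "psum (drop_steps k x) j \<le> psum (drop_steps k x) (Suc n)" by (simp only: psum_add)
  qed
  then show ?case using Suc by (auto simp: record_count_Suc)
qed simp

lemma psum_cong: "(\<And>i. i < n \<Longrightarrow> x i = y i) \<Longrightarrow> k \<le> n \<Longrightarrow> psum x k = psum y k"
  unfolding psum_def by (intro sum.cong) auto

lemma first_record_cong: "(\<And>i. i < k \<Longrightarrow> x i = y i) \<Longrightarrow> first_record x k = first_record y k"
  unfolding first_record_def using psum_cong[of k x y] by (metis atLeastLessThan_iff less_imp_le order_refl)

lemma first_record_offset_unique:
  "first_record x (n - i) \<Longrightarrow> first_record x (n - j) \<Longrightarrow> i = j"
  using first_record_unique[of x "n - i" "n - j"] by (auto simp: first_record_def)

text \<open>A greedy covering of \<open>{1, \<dots>, n}\<close> by blocks with few records, as in Steele's proof of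
  the subadditive ergodic theorem.\<close>

lemma greedy_covering:
  fixes g :: real
  assumes "g \<ge> 0"
  shows "real (record_count x n) \<le> g * real n
     + (\<Sum>i<n. if \<exists>k\<in>{1..K}. real (record_count (drop_steps i x) k) \<le> g * real k then 0 else 1) + real K"
proof (induction n arbitrary: x rule: less_induct)
  case (less n)
  let ?G = "\<lambda>x. \<exists>k\<in>{1..K}. real (record_count x k) \<le> g * real k"
  let ?s = "\<lambda>x n. \<Sum>i<n. if ?G (drop_steps i x) then 0 else 1 :: real"
  have nonneg: "0 \<le> g * real n" "0 \<le> ?s x n" using assms by (auto intro!: sum_nonneg)
  show ?case
  proof (cases "n \<le> K")
    case True
    then show ?thesis using nonneg record_count_le[of x n] by linarith
  next
    case False
    have split: "?s x (k + j) = ?s x k + ?s (drop_steps k x) j" for k j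
      by (induction j) (simp_all add: add.commute)
    \<comment> \<open>At a good start the whole block is skipped at rate \<open>g\<close>; at a bad
      start one step is skipped at cost one. The constant \<open>K\<close> pays for the final
      stretch, which may be too short for a block.\<close>
    show ?thesis
    proof (cases "?G x")
      case True
      then obtain k where k: "k \<in> {1..K}" "real (record_count x k) \<le> g * real k" by blast
      define j where "j = n - k"
      have n: "n = k + j" and "j < n" using k False by (auto simp: j_def)
      have "0 \<le> ?s x k" by (intro sum_nonneg) auto
      moreover have "record_count x n \<le> record_count x k + record_count (drop_steps k x) j"
        unfolding n by (rule record_count_subadd)
      ultimately show ?thesis
        using less.IH[OF \<open>j < n\<close>, of "drop_steps k x"] k(2) split[of k j] unfolding n by (simp add: distrib_left)
    next
      case False': False
      define j where "j = n - 1"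
      have n: "n = 1 + j" and "j < n" using False by (auto simp: j_def)
      have "record_count x n \<le> 1 + record_count (drop_steps 1 x) j"
        unfolding n using record_count_subadd[of x 1 j] record_count_le[of x 1] by linarith
      then show ?thesis
        using less.IH[OF \<open>j < n\<close>, of "drop_steps 1 x"] False' split[of 1 j] assms unfolding n by (simp add: distrib_left)
    qed
  qed
qed

section \<open>Records of a sequence of independent steps\<close>

text \<open>The canonical space of i.i.d. step sequences. Here the whole space consists of all real
  sequences, so events can be written as plain comprehensions.\<close>

locale random_steps = sequence_space N for N :: "real measure" +
  assumes sets_N: "sets N = sets borel"
begin

lemma space_S: "space S = UNIV"
  using sets_eq_imp_space_eq[OF sets_N] by (simp add: space_PiM)

lemma pred_sets: "Measurable.pred S Q \<Longrightarrow> {x. Q x} \<in> sets S"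
  by (drule predE) (simp only: space_S UNIV_I simp_thms)

lemma measurable_coordinate [measurable]: "(\<lambda>x. x i) \<in> borel_measurable S"
proof -
  have "(\<lambda>x. x i) \<in> measurable S N"
    by (rule measurable_component_singleton) simp
  then show ?thesis
    unfolding measurable_cong_sets[OF refl sets_N] .
qed

lemma measurable_psum [measurable]: "(\<lambda>x. psum x n) \<in> borel_measurable S"
  unfolding psum_def by measurable

lemma measurable_psum_le [measurable]: "Measurable.pred S (\<lambda>x. psum x k \<le> psum x n)"
  using pred_intros_logic(2)[OF borel_measurable_pred_less[OF measurable_psum[of n] measurable_psum[of k]]]
  by (simp only: not_less)

lemma measurable_psum_nonneg [measurable]: "Measurable.pred S (\<lambda>x. 0 \<le> psum x n)"
  using measurable_psum_le[of 0 n] by simp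

lemma measurable_psum_neg [measurable]: "Measurable.pred S (\<lambda>x. psum x n < 0)"
  by (intro borel_measurable_pred_less measurable_psum borel_measurable_const)

lemma measurable_is_record [measurable]: "Measurable.pred S (\<lambda>x. is_record x n)"
  unfolding is_record_def
  by (intro pred_intros_countable pred_intros_imp' measurable_psum_le)

lemma measurable_first_record [measurable]: "Measurable.pred S (\<lambda>x. first_record x n)"
  unfolding first_record_def Ball_def
  by (intro pred_intros_countable pred_intros_imp' pred_intros_conj1' pred_intros_logic measurable_psum_nonneg measurable_psum_neg)

lemma measurable_record_count [measurable]: "(\<lambda>x. record_count x n) \<in> measurable S (count_space UNIV)"
  unfolding record_count_sum by measurable

lemma measurable_record_count_eq [measurable]: "Measurable.pred S (\<lambda>x. record_count x n = m)"
  using measurable_compose[OF measurable_record_count measurable_count_space[of "\<lambda>i. i = m"]] .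

lemma measurable_drop_steps [measurable]: "drop_steps k \<in> measurable S S"
  unfolding drop_steps_def by (rule measurable_PiM_single') (auto simp: space_PiM)

text \<open>A product of identical laws is preserved by any injective relabelling of coordinates;
  this covers reversal, rotation and shift at once.\<close>

lemma prob_reindex:
  assumes "inj \<sigma>" and [measurable]: "Measurable.pred S Q"
  shows "P.prob {x. Q (x \<circ> \<sigma>)} = P.prob {x. Q x}"
proof -
  have m [measurable]: "(\<lambda>x. x \<circ> \<sigma>) \<in> measurable S S"
    unfolding comp_def by (rule measurable_PiM_single') (auto simp: space_PiM)
  have "distr S S (\<lambda>x. x \<circ> \<sigma>) = S"
    using distr_PiM_reindex[of UNIV "\<lambda>_. N" \<sigma> UNIV] assms(1) M.prob_space_axioms by (simp add: comp_def restrict_def)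
  then have "P.prob {x. Q x} = measure (distr S S (\<lambda>x. x \<circ> \<sigma>)) {x. Q x}" by simp
  also have "\<dots> = measure S ((\<lambda>x. x \<circ> \<sigma>) -` {x. Q x} \<inter> space S)"
    by (rule measure_distr[OF m]) (use assms(2) in \<open>simp add: pred_def space_S\<close>)
  finally show ?thesis by (simp add: space_S vimage_def)
qed

text \<open>Gluing the first \<open>k\<close> steps of one sequence to another independent sequence
  preserves the law, and the preimage of the joint event under the gluing is a rectangle.\<close>

lemma prob_block:
  assumes [measurable]: "Measurable.pred S R" "Measurable.pred S Q"
    and R: "\<And>x y. (\<And>i. i < k \<Longrightarrow> x i = y i) \<Longrightarrow> R x = R y"
  shows "P.prob {x. R x \<and> Q (drop_steps k x)} = P.prob {x. R x} * P.prob {x. Q x}"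
proof -
  let ?E = "{x. R x \<and> Q (drop_steps k x)}"
  have sets: "?E \<in> sets S" "{x. R x} \<in> sets S" "{x. Q x} \<in> sets S"
    by (rule pred_sets, measurable)+
  have "R (comb_seq k \<omega> \<omega>') = R \<omega>" for \<omega> \<omega>'
    by (rule R) (simp add: comb_seq_less)
  moreover have "drop_steps k (comb_seq k \<omega> \<omega>') = \<omega>'" for \<omega> \<omega>'
    by (simp add: drop_steps_def comb_seq_add)
  ultimately have vimage: "(\<lambda>(\<omega>, \<omega>'). comb_seq k \<omega> \<omega>') -` ?E \<inter> space (S \<Otimes>\<^sub>M S) = {x. R x} \<times> {x. Q x}"
    by (auto simp: space_pair_measure space_S)
  have "emeasure S ?E = emeasure (distr (S \<Otimes>\<^sub>M S) S (\<lambda>(\<omega>, \<omega>'). comb_seq k \<omega> \<omega>')) ?E"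
    by (simp add: PiM_comb_seq)
  also have "\<dots> = emeasure (S \<Otimes>\<^sub>M S) ({x. R x} \<times> {x. Q x})"
    by (subst emeasure_distr[OF measurable_comb_seq sets(1)]) (simp only: vimage)
  also have "\<dots> = emeasure S {x. R x} * emeasure S {x. Q x}"
    by (intro P.emeasure_pair_measure_Times sets)
  finally show ?thesis by (simp add: measure_def enn2real_mult)
qed

lemma prob_drop_steps:
  assumes "Measurable.pred S Q"
  shows "P.prob {x. Q (drop_steps k x)} = P.prob {x. Q x}"
  using prob_reindex[OF _ assms, of "\<lambda>i. i + k"] by (simp add: inj_def comp_def drop_steps_def)

lemma prob_partition:
  assumes "finite K" and Q: "\<And>k. Measurable.pred S (Q k)" and disj: "\<And>j k x. Q j x \<Longrightarrow> Q k x \<Longrightarrow> j = k"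
  shows "P.prob {x. \<exists>k\<in>K. Q k x} = (\<Sum>k\<in>K. P.prob {x. Q k x})"
proof -
  have "{x. \<exists>k\<in>K. Q k x} = (\<Union>k\<in>K. {x. Q k x})" by auto
  then show ?thesis
    using assms(1) disj
    by (simp, intro P.finite_measure_finite_Union) (auto simp: disjoint_family_on_def intro!: pred_sets[OF Q])
qed

section \<open>Probabilities of record events and their convolution identities\<close>

definition epoch_prob :: "nat \<Rightarrow> real" where
  "epoch_prob k = P.prob {x. first_record x k}"

definition record_prob :: "nat \<Rightarrow> real" where
  "record_prob n = P.prob {x. is_record x n}"

definition nth_record_prob :: "nat \<Rightarrow> nat \<Rightarrow> real" where
  "nth_record_prob m n = P.prob {x. is_record x n \<and> record_count x n = m}"

definition stay_prob :: real where
  "stay_prob = P.prob {x. \<forall>k. 0 \<le> psum x k}"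

lemma prob_first_record_block:
  assumes [measurable]: "Measurable.pred S Q"
  shows "P.prob {x. first_record x k \<and> Q (drop_steps k x)} = epoch_prob k * P.prob {x. Q x}"
  unfolding epoch_prob_def by (intro prob_block first_record_cong) measurable

lemma nth_record_prob_Suc:
  "nth_record_prob (Suc m) n = (\<Sum>j\<le>n. nth_record_prob m j * epoch_prob (n - j))"
proof -
  have e0: "epoch_prob 0 = 0" by (simp add: epoch_prob_def first_record_def)
  have "nth_record_prob (Suc m) n = (\<Sum>j<n. nth_record_prob m j * epoch_prob (n - j))"
  proof (cases "n = 0")
    case False
    then have "nth_record_prob (Suc m) n = P.prob {x. \<exists>j\<in>{..<n}. first_record x (n - j) \<and>
        is_record (drop_steps (n - j) x) j \<and> record_count (drop_steps (n - j) x) j = m}"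
      unfolding nth_record_prob_def using record_split_first[of n _ m] by simp
    also have "\<dots> = (\<Sum>j<n. P.prob {x. first_record x (n - j) \<and>
        is_record (drop_steps (n - j) x) j \<and> record_count (drop_steps (n - j) x) j = m})"
      by (rule prob_partition) (measurable, auto intro: first_record_offset_unique)
    also have "\<dots> = (\<Sum>j<n. nth_record_prob m j * epoch_prob (n - j))"
      unfolding nth_record_prob_def
      by (intro sum.cong refl trans[OF prob_first_record_block mult.commute]) measurable
    finally show ?thesis .
  qed (simp add: nth_record_prob_def)
  then show ?thesis by (simp add: lessThan_Suc_atMost[symmetric] e0)
qed

lemma nth_record_prob_0: "nth_record_prob 0 n = (if n = 0 then 1 else 0)"
proof (cases "n = 0")
  case True
  then show ?thesis using P.prob_space by (simp add: nth_record_prob_def space_S)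
next
  case False
  then have "{x. is_record x n \<and> record_count x n = 0} = {}"
    using record_count_strict[of 0 n] by auto
  then show ?thesis using False unfolding nth_record_prob_def by (simp only: measure_empty if_False)
qed

text \<open>One contribution to the convolution: a record at each of the first \<open>m\<close>
  steps.\<close>

lemma nth_record_prob_diag: "nth_record_prob m m \<ge> epoch_prob 1 ^ m"
proof (induction m)
  case (Suc m)
  have "epoch_prob 1 ^ Suc m \<le> nth_record_prob m m * epoch_prob (Suc m - m)"
    using mult_right_mono[OF Suc.IH, of "epoch_prob 1"] by (simp add: epoch_prob_def mult.commute)
  also have "\<dots> \<le> nth_record_prob (Suc m) (Suc m)"
    unfolding nth_record_prob_Suc
    by (rule member_le_sum[of m _ "\<lambda>j. nth_record_prob m j * epoch_prob (Suc m - j)"])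
      (auto simp: nth_record_prob_def epoch_prob_def)
  finally show ?case .
qed (simp add: nth_record_prob_0)

lemma prob_record_count: "P.prob {x. m \<le> record_count x n} = (\<Sum>j\<le>n. nth_record_prob m j)"
proof -
  have "P.prob {x. m \<le> record_count x n} = P.prob {x. \<exists>j\<in>{..n}. is_record x j \<and> record_count x j = m}"
    unfolding record_count_ge_iff ..
  also have "\<dots> = (\<Sum>j\<le>n. nth_record_prob m j)"
    unfolding nth_record_prob_def
  proof (rule prob_partition)
    fix i j x assume "is_record x i \<and> record_count x i = m" "is_record x j \<and> record_count x j = m"
    then show "i = j"
      using record_count_strict[of i j x] record_count_strict[of j i x] by (metis less_irrefl linorder_neqE_nat)
  qed measurable
  finally show ?thesis .
qed

lemma prob_record_from:
  assumes "i < n"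
  shows "P.prob {x. is_record x n \<and> (\<forall>k\<in>{1..i}. psum x k < 0)} = (\<Sum>j<n - i. record_prob j * epoch_prob (n - j))"
proof -
  have "P.prob {x. is_record x n \<and> (\<forall>k\<in>{1..i}. psum x k < 0)} =
      P.prob {x. \<exists>j\<in>{..<n - i}. first_record x (n - j) \<and> is_record (drop_steps (n - j) x) j}"
    using is_record_split_first[OF assms] by simp
  also have "\<dots> = (\<Sum>j<n - i. P.prob {x. first_record x (n - j) \<and> is_record (drop_steps (n - j) x) j})"
    by (rule prob_partition) (measurable, auto intro: first_record_offset_unique)
  also have "\<dots> = (\<Sum>j<n - i. record_prob j * epoch_prob (n - j))"
    unfolding record_prob_def
    by (intro sum.cong refl trans[OF prob_first_record_block mult.commute]) measurable
  finally show ?thesis .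
qed

lemma record_prob_Suc: "record_prob (Suc n) = (\<Sum>j\<le>n. record_prob j * epoch_prob (Suc n - j))"
  using prob_record_from[of 0 "Suc n"] by (simp add: record_prob_def lessThan_Suc_atMost)

lemma record_prob_dual: "record_prob n = P.prob {x. \<forall>k\<le>n. 0 \<le> psum x k}"
proof -
  define \<sigma> where "\<sigma> = (\<lambda>i. if i < n then n - 1 - i else i)"
  have "inj \<sigma>" by (auto simp: inj_def \<sigma>_def split: if_splits)
  from prob_reindex[OF this measurable_is_record[of n]] show ?thesis
    unfolding record_prob_def is_record_rev[OF \<sigma>_def] by simp
qed

lemma record_prob_lim: "record_prob \<longlonglongrightarrow> stay_prob"
proof -
  have "(\<lambda>n. P.prob {x. \<forall>k\<le>n. 0 \<le> psum x k}) \<longlonglongrightarrow> P.prob (\<Inter>n. {x. \<forall>k\<le>n. 0 \<le> psum x k})"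
    by (rule P.finite_Lim_measure_decseq) (auto simp: decseq_def intro!: pred_sets)
  moreover have "(\<Inter>n. {x. \<forall>k\<le>n. 0 \<le> psum x k}) = {x. \<forall>k. 0 \<le> psum x k}" by auto
  ultimately show ?thesis by (simp add: record_prob_dual[abs_def] stay_prob_def)
qed

lemma record_prob_ge: "stay_prob \<le> record_prob n"
  unfolding record_prob_dual stay_prob_def
  by (rule P.finite_measure_mono) (auto intro!: pred_sets)

lemma prob_nonneg_rotation:
  assumes "n > 0"
  shows "P.prob {x. 0 \<le> psum x n} = (\<Sum>j\<le>n. record_prob j * (real (n - j) * epoch_prob (n - j)))"
proof -
  let ?L = "\<lambda>p x. p \<in> {1..n} \<and> 0 \<le> psum x n \<and> (\<forall>m\<in>{1..n}. psum x m \<le> psum x p \<and> (p < m \<longrightarrow> psum x m < psum x p))"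
  have "P.prob {x. 0 \<le> psum x n} = P.prob {x. \<exists>p\<in>{1..n}. ?L p x}"
    using last_argmax_exists[OF assms] by (intro arg_cong[of _ _ P.prob]) blast
  also have "\<dots> = (\<Sum>p\<in>{1..n}. P.prob {x. ?L p x})"
  proof (rule prob_partition)
    fix j k x assume "?L j x" "?L k x"
    then show "j = k" by (metis linorder_neqE_nat not_less)
  qed measurable
  also have "\<dots> = (\<Sum>p\<in>{1..n}. P.prob {x. is_record x n \<and> (\<forall>k\<in>{1..n - p}. psum x k < 0)})"
  proof (rule sum.cong[OF refl])
    fix p assume p: "p \<in> {1..n}"
    define \<sigma> where "\<sigma> = (\<lambda>a. if a < n - p then p + a else if a < n then a - (n - p) else a)"
    have "inj \<sigma>" using p by (auto simp: inj_def \<sigma>_def split: if_splits)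
    moreover have "Measurable.pred S (\<lambda>x. is_record x n \<and> (\<forall>k\<in>{1..n - p}. psum x k < 0))" by measurable
    ultimately have "P.prob {x. is_record (x \<circ> \<sigma>) n \<and> (\<forall>k\<in>{1..n - p}. psum (x \<circ> \<sigma>) k < 0)} =
        P.prob {x. is_record x n \<and> (\<forall>k\<in>{1..n - p}. psum x k < 0)}"
      by (rule prob_reindex)
    then show "P.prob {x. ?L p x} = P.prob {x. is_record x n \<and> (\<forall>k\<in>{1..n - p}. psum x k < 0)}"
      unfolding is_record_rotate[OF p \<sigma>_def] using p by simp
  qed
  also have "\<dots> = (\<Sum>p\<in>{1..n}. \<Sum>j<p. record_prob j * epoch_prob (n - j))"
    by (intro sum.cong refl, subst prob_record_from) auto
  also have "\<dots> = (\<Sum>p\<in>{1..n}. \<Sum>j\<in>{j\<in>{..n}. j < p}. record_prob j * epoch_prob (n - j))"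
    by (intro sum.cong) auto
  \<comment> \<open>For fixed \<open>j\<close> the admissible rotations are those with
    \<open>j < p \<le> n\<close>. Their number \<open>n - j\<close> is the origin of the weight in
    the identity.\<close>
  also have "\<dots> = (\<Sum>j\<le>n. \<Sum>p\<in>{p\<in>{1..n}. j < p}. record_prob j * epoch_prob (n - j))"
    by (rule sum.swap_restrict) auto
  also have "\<dots> = (\<Sum>j\<le>n. record_prob j * (real (n - j) * epoch_prob (n - j)))"
  proof (rule sum.cong[OF refl])
    fix j assume "j \<in> {..n}"
    have "{p\<in>{1..n}. j < p} = {j<..n}" by auto
    then show "(\<Sum>p\<in>{p\<in>{1..n}. j < p}. record_prob j * epoch_prob (n - j)) = record_prob j * (real (n - j) * epoch_prob (n - j))"
      by simp
  qed
  finally show ?thesis .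
qed

lemma measurable_drop_steps_pred [measurable]:
  "Measurable.pred S Q \<Longrightarrow> Measurable.pred S (\<lambda>x. Q (drop_steps k x))"
  by (rule measurable_compose[OF measurable_drop_steps])

text \<open>A time \<open>m\<close> after which the path never falls below its value at
  \<open>m\<close> is one whose shifted path stays nonnegative. With \<open>stay_prob = 0\<close>
  each of the countably many shifts would do so with probability zero.\<close>

lemma stay_prob_pos_if_argmin:
  assumes "AE x in S. \<exists>m. \<forall>k. psum x m \<le> psum x (m + k)"
  shows "stay_prob > 0"
proof (rule ccontr)
  assume "\<not> stay_prob > 0"
  then have "stay_prob = 0" by (simp add: stay_prob_def order_antisym)
  let ?Q = "\<lambda>x. \<forall>k. 0 \<le> psum x k"
  have Q: "Measurable.pred S ?Q" by measurable
  have "AE x in S. \<not> ?Q (drop_steps m x)" for m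
  proof -
    have "P.prob {x. ?Q (drop_steps m x)} = 0"
      using prob_drop_steps[OF Q, of m] \<open>stay_prob = 0\<close> unfolding stay_prob_def by simp
    then show ?thesis
      by (subst (asm) P.prob_eq_0[OF pred_sets[OF measurable_drop_steps_pred[OF Q]]]) simp
  qed
  then have "AE x in S. \<forall>m. \<not> ?Q (drop_steps m x)" by (simp add: AE_all_countable)
  with assms have "AE x in S. False"
    by eventually_elim (auto simp: psum_add)
  then show False by (simp add: P.AE_False)
qed

lemma stay_prob_0:
  assumes "AE x in S. \<exists>k. psum x k < 0"
  shows "stay_prob = 0"
  unfolding stay_prob_def
proof (subst P.prob_eq_0)
  show "{x. \<forall>k. 0 \<le> psum x k} \<in> sets S" by (rule pred_sets) measurable
  show "AE x in S. x \<notin> {x. \<forall>k. 0 \<le> psum x k}"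
    using assms by eventually_elim (auto simp: not_le)
qed

lemma expected_record_count:
  assumes [measurable]: "Measurable.pred S Q"
  shows "integrable S (\<lambda>x. indicator {x. Q x} x * real (record_count x n))"
    and "(\<integral>x. indicator {x. Q x} x * real (record_count x n) \<partial>S) = (\<Sum>k=1..n. P.prob {x. Q x \<and> is_record x k})"
proof -
  have eq: "indicator {x. Q x} x * real (record_count x n) = (\<Sum>k=1..n. indicator {x. Q x \<and> is_record x k} x)" for x
  proof -
    have "real (record_count x n) = (\<Sum>k=1..n. indicator {x. is_record x k} x)"
      by (induction n) (auto simp: record_count_Suc)
    then show ?thesis by (cases "Q x") (simp_all add: indicator_def)
  qed
  have int: "integrable S (indicator {x. Q x \<and> is_record x k} :: _ \<Rightarrow> real)" for k
    by (rule integrable_real_indicator) (auto intro!: pred_sets simp: P.emeasure_finite less_top[symmetric])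
  show "integrable S (\<lambda>x. indicator {x. Q x} x * real (record_count x n))"
    unfolding eq by (intro Bochner_Integration.integrable_sum int)
  show "(\<integral>x. indicator {x. Q x} x * real (record_count x n) \<partial>S) = (\<Sum>k=1..n. P.prob {x. Q x \<and> is_record x k})"
    unfolding eq by (subst Bochner_Integration.integral_sum[OF int]) (simp add: space_S)
qed

text \<open>\<open>B\<close> says that the records fall behind \<open>g * n\<close> by arbitrarily
  much. On \<open>B\<close> the expected number of records up to \<open>n\<close> is at least
  \<open>n * stay_prob * b\<close>, because \<open>B\<close> is independent of a record at
  \<open>k\<close>; by the greedy covering it is at most \<open>g * n * b\<close> up to terms that
  are negligible against \<open>n\<close>. Hence \<open>b = 0\<close>.\<close>

lemma few_records_null:
  assumes g: "0 \<le> g" "g < stay_prob"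
  shows "P.prob {x. \<forall>m. \<exists>n. real (record_count x n) + real m \<le> g * real n} = 0"
proof -
  define B where "B x \<longleftrightarrow> (\<forall>m. \<exists>n. real (record_count x n) + real m \<le> g * real n)" for x
  define G where "G K x \<longleftrightarrow> (\<exists>k\<in>{1..K}. real (record_count x k) \<le> g * real k)" for K x
  have [measurable]: "Measurable.pred S (\<lambda>x. Q (record_count x n))" for Q :: "nat \<Rightarrow> bool" and n
    by (rule measurable_compose[OF measurable_record_count]) simp
  have B [measurable]: "Measurable.pred S B" unfolding B_def[abs_def] by measurable
  have G [measurable]: "Measurable.pred S (G K)" for K unfolding G_def[abs_def] by measurable
  define b where "b = P.prob {x. B x}"
  define d where "d K = P.prob {x. B x \<and> \<not> G K x}" for K
  \<comment> \<open>One additional initial step adds at most one record, and the arbitrary offset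
    \<open>m\<close> absorbs it.\<close>
  have step: "B x" if "B (drop_steps 1 x)" for x
    unfolding B_def
  proof
    fix m
    obtain n where "real (record_count (drop_steps 1 x) n) + real (Suc m) \<le> g * real n" using \<open>B (drop_steps 1 x)\<close> unfolding B_def by blast
    moreover have "real (record_count x (1 + n)) \<le> 1 + real (record_count (drop_steps 1 x) n)"
      using record_count_subadd[of x 1 n] record_count_le[of x 1] by linarith
    ultimately have "real (record_count x (1 + n)) + real m \<le> g * real (1 + n)"
      using g by (simp add: distrib_left)
    then show "\<exists>n. real (record_count x n) + real m \<le> g * real n" by blast
  qed
  have sub: "B x" if "B (drop_steps k x)" for k x
    using that
  proof (induction k)
    case (Suc k)
    then have "B (drop_steps 1 (drop_steps k x))" by simp
    then have "B (drop_steps k x)" by (rule step)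
    then show ?case by (rule Suc.IH)
  qed simp
  \<comment> \<open>One inclusion between \<open>B\<close> and its shift holds pathwise and both
    have the same probability, so they agree up to a null set.\<close>
  have invariant: "P.prob {x. B x \<and> Q x} = P.prob {x. B (drop_steps k x) \<and> Q x}"
    if [measurable]: "Measurable.pred S Q" for Q k
  proof (rule P.finite_measure_eq_AE)
    have "P.prob ({x. B x} - {x. B (drop_steps k x)}) = P.prob {x. B x} - P.prob {x. B (drop_steps k x)}"
      using sub by (intro P.finite_measure_Diff pred_sets measurable_drop_steps_pred B) auto
    also have "\<dots> = 0" using prob_drop_steps[OF B, of k] by simp
    finally have "AE x in S. x \<notin> {x. B x} - {x. B (drop_steps k x)}"
      by (subst (asm) P.prob_eq_0) (intro sets.Diff pred_sets measurable_drop_steps_pred B, simp)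
    then show "AE x in S. (x \<in> {x. B x \<and> Q x}) = (x \<in> {x. B (drop_steps k x) \<and> Q x})"
      by eventually_elim (use sub in blast)
  qed (rule pred_sets, measurable)+
  \<comment> \<open>Once \<open>B\<close> is moved beyond time \<open>k\<close>, it is independent
    of the first \<open>k\<close> steps, which decide whether \<open>k\<close> is a record.\<close>
  have rec: "P.prob {x. B x \<and> is_record x k} \<ge> stay_prob * b" for k
  proof -
    have "P.prob {x. B x \<and> is_record x k} = P.prob {x. is_record x k \<and> B (drop_steps k x)}"
      by (subst invariant[of _ k]) (measurable, simp add: conj_commute)
    also have "\<dots> = record_prob k * b"
      unfolding record_prob_def b_def
    proof (intro prob_block)
      fix x y :: "nat \<Rightarrow> real" assume "\<And>i. i < k \<Longrightarrow> x i = y i"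
      then show "is_record x k = is_record y k"
        unfolding is_record_def using psum_cong[of k x y] by simp
    qed measurable
    also have "\<dots> \<ge> stay_prob * b"
      using record_prob_ge by (intro mult_right_mono) (auto simp: b_def)
    finally show ?thesis .
  qed
  have bad: "P.prob {x. B x \<and> \<not> G K (drop_steps i x)} = d K" for i K
  proof -
    have "P.prob {x. B x \<and> \<not> G K (drop_steps i x)} = P.prob {x. B (drop_steps i x) \<and> \<not> G K (drop_steps i x)}"
      by (rule invariant) measurable
    also have "\<dots> = d K"
      unfolding d_def by (rule prob_drop_steps[of "\<lambda>x. B x \<and> \<not> G K x"]) measurable
    finally show ?thesis .
  qed
  have bound: "real n * (stay_prob * b) \<le> g * real n * b + real n * d K + real K * b" for n K
  proof -
    have int: "integrable S (indicator {x. R x} :: _ \<Rightarrow> real)" if "Measurable.pred S R" for R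
      using pred_sets[OF that] by (intro integrable_real_indicator) (auto simp: P.emeasure_finite less_top[symmetric])
    let ?r = "\<lambda>x. g * real n * indicator {x. B x} x + (\<Sum>i<n. indicator {x. B x \<and> \<not> G K (drop_steps i x)} x)
         + real K * indicator {x. B x} x :: real"
    have le: "indicator {x. B x} x * real (record_count x n) \<le> ?r x" for x
    proof (cases "B x")
      case True
      have "(\<Sum>i<n. if G K (drop_steps i x) then 0 else 1) = (\<Sum>i<n. indicator {x. B x \<and> \<not> G K (drop_steps i x)} x :: real)"
        using True by (intro sum.cong) auto
      then show ?thesis using True greedy_covering[OF g(1), of x n K] by (simp add: G_def)
    qed (auto intro!: sum_nonneg)
    have "real n * (stay_prob * b) \<le> (\<Sum>k=1..n. P.prob {x. B x \<and> is_record x k})"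
      using sum_mono[of "{1..n}" "\<lambda>_. stay_prob * b", OF rec] by simp
    also have "\<dots> = (\<integral>x. indicator {x. B x} x * real (record_count x n) \<partial>S)"
      by (rule expected_record_count(2)[OF B, symmetric])
    also have "\<dots> \<le> (\<integral>x. ?r x \<partial>S)"
      by (intro integral_mono expected_record_count(1)[OF B] le Bochner_Integration.integrable_add
           Bochner_Integration.integrable_sum integrable_mult_right int) measurable
    also have "\<dots> = g * real n * b + real n * d K + real K * b"
    proof -
      have "integrable S (indicator {x. B x} :: _ \<Rightarrow> real)"
        "\<And>i. integrable S (indicator {x. B x \<and> \<not> G K (drop_steps i x)} :: _ \<Rightarrow> real)"
        by (rule int, measurable)+
      then show ?thesis by (simp add: bad b_def space_S)
    qed
    finally show ?thesis .
  qed
  \<comment> \<open>On \<open>B\<close> the offset \<open>m = 1\<close> produces a positive time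
    with few records, so every path in \<open>B\<close> has a good start for some
    \<open>K\<close>.\<close>
  have "d \<longlonglongrightarrow> P.prob (\<Inter>K. {x. B x \<and> \<not> G K x})"
    unfolding d_def by (rule P.finite_Lim_measure_decseq) (force simp: decseq_def G_def intro!: pred_sets)+
  moreover have "(\<Inter>K. {x. B x \<and> \<not> G K x}) = {}"
  proof -
    have "\<exists>K. G K x" if "B x" for x
    proof -
      have "\<exists>n. real (record_count x n) + real 1 \<le> g * real n" using that unfolding B_def by (rule spec)
      then obtain n where n: "real (record_count x n) + real 1 \<le> g * real n" ..
      then have "n \<noteq> 0" by (cases n) auto
      then show ?thesis using n unfolding G_def by (intro exI[of _ n] bexI[of _ n]) auto
    qed
    then show ?thesis by blast
  qed
  ultimately have d0: "d \<longlonglongrightarrow> 0" by simp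
  \<comment> \<open>The term \<open>real K * b\<close> disappears on division by \<open>n\<close>,
    with \<open>K\<close> fixed; only then does \<open>K\<close> tend to infinity.\<close>
  have "(stay_prob - g) * b \<le> d K" for K
  proof (rule tendsto_lowerbound[of "\<lambda>n. d K + real K * b / real n" _ sequentially])
    show "(\<lambda>n. d K + real K * b / real n) \<longlonglongrightarrow> d K"
      using tendsto_add[OF tendsto_const lim_const_over_n] by fastforce
    show "\<forall>\<^sub>F n in sequentially. (stay_prob - g) * b \<le> d K + real K * b / real n"
    proof (rule eventually_sequentiallyI[of 1])
      fix n :: nat assume "1 \<le> n"
      then show "(stay_prob - g) * b \<le> d K + real K * b / real n"
        using bound[of n K] by (simp add: field_simps)
    qed
  qed simp
  then have "(stay_prob - g) * b \<le> 0"
    using d0 by (intro tendsto_lowerbound[OF d0] always_eventually) auto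
  moreover have "b \<ge> 0" by (simp add: b_def)
  ultimately show ?thesis using g unfolding b_def B_def by (simp add: mult_le_0_iff)
qed

end

locale recurrent_steps = random_steps +
  assumes recurrent: "AE x in S. \<exists>n>0. 0 \<le> psum x n"
begin

lemma epoch_prob_sums: "epoch_prob sums 1"
proof -
  have "(\<lambda>k. P.prob {x. first_record x k}) sums P.prob (\<Union>k. {x. first_record x k})"
    by (rule P.finite_measure_UNION)
      (auto simp: disjoint_family_on_def intro!: pred_sets measurable_first_record dest: first_record_unique)
  moreover have "P.prob (\<Union>k. {x. first_record x k}) = 1"
  proof (subst P.prob_eq_1)
    show "(\<Union>k. {x. first_record x k}) \<in> sets S"
      by (intro sets.countable_UN) (auto intro!: pred_sets measurable_first_record)
    show "AE x in S. x \<in> (\<Union>k. {x. first_record x k})"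
      using recurrent by eventually_elim (use first_record_exists in blast)
  qed
  ultimately show ?thesis by (simp add: epoch_prob_def[abs_def])
qed

lemma epoch_prob_1_eq: "epoch_prob 1 = P.prob {x. 0 \<le> x 0}"
  by (simp add: epoch_prob_def first_record_def psum_def)

lemma epoch_prob_0: "epoch_prob 0 = 0"
  by (simp add: epoch_prob_def first_record_def)

text \<open>The step that leads to the first record starts from a level \<open>\<le> 0\<close> and
  is therefore nonnegative. If such steps had probability zero, no first record could ever
  occur.\<close>

lemma epoch_prob_1_pos: "epoch_prob 1 > 0"
proof (rule ccontr)
  assume "\<not> epoch_prob 1 > 0"
  then have "epoch_prob 1 = 0"
    unfolding epoch_prob_def by (metis measure_nonneg not_less order_antisym)
  then have 0: "P.prob {x. 0 \<le> psum x 1} = 0"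
    using epoch_prob_1_eq by (simp add: psum_def)
  have "epoch_prob k = 0" for k
  proof (cases k)
    case (Suc n)
    have "epoch_prob k \<le> P.prob {x. 0 \<le> psum (drop_steps n x) 1}"
      unfolding epoch_prob_def
    proof (rule P.finite_measure_mono)
      show "{x. 0 \<le> psum (drop_steps n x) 1} \<in> sets S"
        by (rule pred_sets[OF measurable_drop_steps_pred[OF measurable_psum_nonneg]])
      show "{x. first_record x k} \<subseteq> {x. 0 \<le> psum (drop_steps n x) 1}"
      proof safe
        fix x assume x: "first_record x k"
        have "psum x n \<le> 0"
          using x Suc by (cases "n = 0") (auto simp: first_record_def less_imp_le)
        moreover have "psum x k = psum x n + psum (drop_steps n x) 1"
          using psum_add[of x n 1] Suc by simp
        ultimately show "0 \<le> psum (drop_steps n x) 1" using x by (simp add: first_record_def)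
      qed
    qed
    also have "\<dots> = 0" using prob_drop_steps[OF measurable_psum_nonneg[of 1], of n] 0 by simp
    finally show ?thesis by (simp add: epoch_prob_def order_antisym)
  qed (simp add: epoch_prob_0)
  then have "epoch_prob = (\<lambda>_. 0)" by auto
  then show False using epoch_prob_sums by (simp add: sums_iff)
qed

sublocale W: waiting_time epoch_prob
  by unfold_locales (simp_all add: epoch_prob_0 epoch_prob_sums epoch_prob_1_pos[simplified], simp add: epoch_prob_def)

lemma nth_record_prob_powser:
  assumes "l < 0"
  shows "(\<lambda>n. nth_record_prob m n * exp (l * real n)) sums (W.Phi l ^ m)"
proof (induction m)
  case 0
  show ?case using sums_single[of 0 "\<lambda>_. 1 :: real"] by (simp add: nth_record_prob_0 if_distrib if_distribR cong: if_cong)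
next
  case (Suc m)
  let ?a = "\<lambda>n. nth_record_prob m n * exp (l * real n)" and ?b = "\<lambda>n. epoch_prob n * exp (l * real n)"
  have "summable ?b" using assms by (intro W.summable_Phi) simp
  then have "summable (\<lambda>n. norm (?a n))" "summable (\<lambda>n. norm (?b n))"
    using Suc.IH by (simp_all add: sums_iff nth_record_prob_def epoch_prob_def)
  from Cauchy_product_sums[OF this]
  have "(\<lambda>n. \<Sum>j\<le>n. ?a j * ?b (n - j)) sums (W.Phi l ^ m * W.Phi l)"
    using Suc.IH by (simp add: sums_iff W.Phi_def)
  moreover have "(\<Sum>j\<le>n. ?a j * ?b (n - j)) = nth_record_prob (Suc m) n * exp (l * real n)" for n
    unfolding nth_record_prob_Suc sum_distrib_right
  proof (rule sum.cong[OF refl])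
    fix j assume "j \<in> {..n}"
    then have "exp (l * real n) = exp (l * real j) * exp (l * real (n - j))"
      by (simp add: exp_add[symmetric] distrib_left[symmetric])
    then show "?a j * ?b (n - j) = nth_record_prob m j * epoch_prob (n - j) * exp (l * real n)"
      by (simp only: mult_ac)
  qed
  ultimately show ?case by (simp only: power_Suc2)
qed

sublocale W: waiting_time_sums epoch_prob nth_record_prob
  by unfold_locales (simp_all add: nth_record_prob_powser, simp add: nth_record_prob_def)

section \<open>Large deviations and the law of large numbers on the sequence space\<close>

definition nonneg_prob :: "nat \<Rightarrow> real" where
  "nonneg_prob n = (if n = 0 then 0 else P.prob {x. 0 \<le> psum x n})"

sublocale R: spitzer epoch_prob record_prob stay_prob nonneg_prob
proof unfold_locales
  show "record_prob 0 = 1" using P.prob_space by (simp add: record_prob_def space_S)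
  show "nonneg_prob n = (\<Sum>j\<le>n. record_prob j * (real (n - j) * epoch_prob (n - j)))" for n
    using prob_nonneg_rotation[of n] by (simp add: nonneg_prob_def)
  show "record_prob (Suc n) = (\<Sum>j\<le>n. record_prob j * epoch_prob (Suc n - j))" for n
    by (rule record_prob_Suc)
qed (use epoch_prob_sums epoch_prob_0 record_prob_lim record_prob_ge in
    \<open>simp_all add: nonneg_prob_def record_prob_def stay_prob_def epoch_prob_def\<close>)

lemma mass_eq: "W.mass m n = P.prob {x. m \<le> record_count x n}"
  by (simp add: W.mass_def prob_record_count)

text \<open>\<open>Suc\<close> counts the record at time \<open>0\<close>. Truncated subtraction
  does no harm: for \<open>real n * y \<le> 1\<close> both sides hold.\<close>

lemma Suc_record_count_iff:
  "real (Suc (record_count x n)) \<ge> real n * y \<longleftrightarrow> nat \<lceil>real n * y\<rceil> - 1 \<le> record_count x n"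
  by (simp add: ceiling_le_iff[symmetric]) linarith

lemma tilt_root:
  assumes "1 < a" "a < (\<Sum>j<J. R.tail j)"
  shows "\<exists>l<0. W.tilt a l = 0"
  using R.mean_exceeds[OF assms(2)] W.tilt_root_exists[OF assms(1)] by blast

text \<open>For \<open>y < 1\<close> the certificate \<open>J\<close> also yields roots at all
  levels between one and \<open>1 / y\<close>, which the change of measure requires. At
  \<open>y = 1\<close> the diagonal bound takes its place.\<close>

lemma record_ldp:
  assumes y: "0 < y" "y \<le> 1" and J: "y < 1 \<Longrightarrow> 1 / y < (\<Sum>j<J. R.tail j)"
  shows "(\<lambda>n. ereal (1 / real n) * elog (P.prob {x. real (Suc (record_count x n)) \<ge> real n * y}))
    \<longlonglongrightarrow> - (ereal y * W.legendre (1 / y))"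
proof (cases "y < 1")
  case False
  then have "y = 1" using y by simp
  have p: "epoch_prob 1 \<le> 1" by (simp add: epoch_prob_def)
  have "(\<lambda>n. ereal (1 / real n) * elog (W.mass (nat \<lceil>real n * 1\<rceil> - 1) n)) \<longlonglongrightarrow> - (ereal 1 * ereal (- ln (epoch_prob 1)))"
  proof (rule W.mass_ldp)
    show "\<exists>l<0. l * (1 / 1) - W.Lam l > - ln (epoch_prob 1) - e" if "e > 0" for e
      using W.legendre_one_approx[OF that] by simp
    show "\<forall>\<^sub>F m in sequentially. \<forall>n. real n \<ge> real m * (1 / 1) \<longrightarrow> W.mass m n \<ge> exp (- (real m * (- ln (epoch_prob 1) + e)))" if "e > 0" for e
      using W.mass_diag_lower[OF nth_record_prob_diag that] by simp
  qed (use p epoch_prob_1_pos in auto)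
  then show ?thesis
    using W.legendre_one unfolding mass_eq Suc_record_count_iff \<open>y = 1\<close> by simp
next
  case True
  then have c: "1 < 1 / y" "1 / y < (\<Sum>j<J. R.tail j)" using y J by auto
  from tilt_root[OF c] obtain l where l: "l < 0" "W.tilt (1 / y) l = 0" by blast
  have "(\<lambda>n. ereal (1 / real n) * elog (W.mass (nat \<lceil>real n * y\<rceil> - 1) n)) \<longlonglongrightarrow> - (ereal y * ereal (l * (1 / y) - W.Lam l))"
  proof (rule W.mass_ldp)
    show "\<exists>m<0. m * (1 / y) - W.Lam m > l * (1 / y) - W.Lam l - e" if "e > 0" for e
      using l that by (intro exI[of _ l]) simp
    show "l * (1 / y) - W.Lam l \<ge> 0"
      using W.legendre_root_pos[OF c(1) l] by simp
    show "\<forall>\<^sub>F m in sequentially. \<forall>n. real n \<ge> real m * (1 / y) \<longrightarrow> W.mass m n \<ge> exp (- (real m * (l * (1 / y) - W.Lam l + e)))" if "e > 0" for e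
    proof (rule W.mass_lower[OF c(1) l _ that])
      fix a assume "1 < a" "a < 1 / y"
      then show "\<exists>l<0. W.tilt a l = 0" using c(2) by (intro tilt_root) (auto intro: less_trans)
    qed
  qed (use y in auto)
  then show ?thesis
    using W.legendre_root[OF c(1) l] unfolding mass_eq Suc_record_count_iff by simp
qed

lemma record_upper:
  assumes y: "0 < y" "y < 1" and J: "1 / y < (\<Sum>j<J. R.tail j)"
  shows "AE x in S. \<forall>\<^sub>F n in sequentially. real (Suc (record_count x n)) < real n * y"
proof -
  have c: "1 < 1 / y" using y by simp
  from tilt_root[OF c J] obtain l where l: "l < 0" "W.tilt (1 / y) l = 0" by blast
  \<comment> \<open>The exponential decay rate per unit of time; the rate per record is multiplied
    by the record density \<open>y\<close>.\<close>
  define d where "d = y * (l * (1 / y) - W.Lam l)"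
  have d: "d > 0" unfolding d_def using W.legendre_root_pos[OF c l] y by (intro mult_pos_pos)
  have Lam: "W.Lam l \<le> 0" unfolding W.Lam_def using W.Phi_le_1[of l] W.Phi_pos[of l] l by simp
  let ?A = "\<lambda>n. {x. real (Suc (record_count x n)) \<ge> real n * y}"
  have [measurable]: "Measurable.pred S (\<lambda>x. Q (record_count x n))" for Q :: "nat \<Rightarrow> bool" and n
    by (rule measurable_compose[OF measurable_record_count]) simp
  have sets: "?A n \<in> sets S" for n by (rule pred_sets) measurable
  have le: "P.prob (?A n) \<le> exp (- W.Lam l) * exp (- d) ^ n" for n
  proof -
    define m where "m = nat \<lceil>real n * y\<rceil> - 1"
    have m: "real n * y - 1 \<le> real m" unfolding m_def by linarith
    have "P.prob (?A n) = W.mass m n"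
      unfolding mass_eq Suc_record_count_iff m_def ..
    also have "\<dots> \<le> exp (- l * real n) * W.Phi l ^ m"
      by (rule W.mass_chernoff[OF l(1)])
    also have "W.Phi l ^ m = exp (real m * W.Lam l)"
      using l W.exp_Lam[of l] by (simp add: exp_of_nat_mult)
    also have "exp (- l * real n) * exp (real m * W.Lam l) \<le> exp (- l * real n) * exp ((real n * y - 1) * W.Lam l)"
      using m Lam by (intro mult_left_mono) (auto intro: mult_right_mono_neg)
    also have "\<dots> = exp (- W.Lam l) * exp (- d) ^ n"
      using y by (simp add: d_def exp_of_nat_mult[symmetric] exp_add[symmetric] algebra_simps)
    finally show ?thesis .
  qed
  have "summable (\<lambda>n. P.prob (?A n))"
    by (rule summable_comparison_test'[OF summable_mult[OF summable_geometric[of "exp (- d)"]]])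
      (use le d in auto)
  then have "AE x in S. \<forall>\<^sub>F n in sequentially. x \<in> space S - ?A n"
    using sets by (intro borel_cantelli_AE1) (auto simp: P.emeasure_finite less_top[symmetric])
  then show ?thesis
    by eventually_elim (auto simp: not_le elim!: eventually_mono)
qed

lemma record_lower:
  assumes "0 \<le> g" "g < stay_prob"
  shows "AE x in S. \<exists>m. \<forall>n. g * real n < real (record_count x n) + real m"
proof -
  have [measurable]: "Measurable.pred S (\<lambda>x. Q (record_count x n))" for Q :: "nat \<Rightarrow> bool" and n
    by (rule measurable_compose[OF measurable_record_count]) simp
  have B: "Measurable.pred S (\<lambda>x. \<forall>m. \<exists>n. real (record_count x n) + real m \<le> g * real n)" by measurable
  have "AE x in S. x \<notin> {x. \<forall>m. \<exists>n. real (record_count x n) + real m \<le> g * real n}"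
    using few_records_null[OF assms] by (subst (asm) P.prob_eq_0[OF pred_sets[OF B]])
  then show ?thesis by eventually_elim (auto simp: not_le)
qed

lemma record_rate:
  assumes q: "stay_prob > 0"
  shows "AE x in S. (\<lambda>n. real (Suc (record_count x n)) / real n) \<longlonglongrightarrow> stay_prob"
proof -
  have tail: "summable R.tail" "stay_prob * (\<Sum>n. R.tail n) = 1"
    using R.summable_tail[OF q] R.suminf_tail by auto
  have up: "AE x in S. \<forall>\<^sub>F n in sequentially. real (Suc (record_count x n)) / real n < stay_prob + e" if e: "e > 0" for e
  proof (cases "stay_prob < 1")
    case True
    \<comment> \<open>Strictly between \<open>stay_prob\<close> and one, and within \<open>e\<close>
      of \<open>stay_prob\<close>: then \<open>1 / y\<close> is below the mean and the deviation
      bound applies.\<close>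
    define y where "y = min (stay_prob + e) ((stay_prob + 1) / 2)"
    have y: "stay_prob < y" "y < 1" "0 < y" "y \<le> stay_prob + e" using True q e by (auto simp: y_def min_less_iff_disj)
    have "1 / y < 1 / stay_prob" using y q by (intro divide_strict_left_mono) auto
    also have "1 / stay_prob = (\<Sum>n. R.tail n)" using tail q by (simp add: field_simps)
    finally have "\<forall>\<^sub>F J in sequentially. 1 / y < (\<Sum>j<J. R.tail j)"
      using summable_LIMSEQ[OF tail(1)] by (intro order_tendstoD)
    then obtain J where "1 / y < (\<Sum>j<J. R.tail j)"
      using eventually_happens'[OF sequentially_bot] by blast
    from record_upper[OF y(3,2) this] show ?thesis
    proof eventually_elim
      case (elim x)
      then show ?case using eventually_gt_at_top[of 0]
      proof eventually_elim
        case (elim n)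
        then have "real (Suc (record_count x n)) / real n < y" by (simp add: divide_less_eq mult.commute)
        then show ?case using y(4) by linarith
      qed
    qed
  next
    \<comment> \<open>No level below one lies above \<open>stay_prob\<close>, but then the trivial
      bound \<open>n + 1\<close> on the number of records is sharp enough.\<close>
    case False
    have "(\<lambda>n. 1 / real n) \<longlonglongrightarrow> 0" by (rule lim_1_over_n)
    then have "\<forall>\<^sub>F n in sequentially. 1 / real n < e" using e by (rule order_tendstoD)
    then have "\<forall>\<^sub>F n in sequentially. real (Suc (record_count x n)) / real n < stay_prob + e" for x
      using eventually_gt_at_top[of 0]
    proof eventually_elim
      case (elim n)
      have "real (Suc (record_count x n)) / real n \<le> (real n + 1) / real n"
        using record_count_le[of x n] by (intro divide_right_mono) auto
      also have "\<dots> = 1 + 1 / real n" using elim by (simp add: field_simps)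
      finally show ?case using False elim by linarith
    qed
    then show ?thesis by simp
  qed
  have low: "AE x in S. \<forall>\<^sub>F n in sequentially. stay_prob - e < real (Suc (record_count x n)) / real n" if e: "e > 0" for e
  proof -
    \<comment> \<open>The greedy covering works with nonnegative rates, hence the cut at
      zero.\<close>
    define g where "g = max 0 (stay_prob - e / 2)"
    have g: "0 \<le> g" "g < stay_prob" "stay_prob - e / 2 \<le> g" using q e by (auto simp: g_def)
    from record_lower[OF g(1,2)] show ?thesis
    proof eventually_elim
      case (elim x)
      then obtain m where m: "\<And>n. g * real n < real (record_count x n) + real m" by blast
      have "(\<lambda>n. real m / real n) \<longlonglongrightarrow> 0" by (rule lim_const_over_n)
      then have "\<forall>\<^sub>F n in sequentially. real m / real n < e / 2" using e by (intro order_tendstoD) auto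
      then show ?case using eventually_gt_at_top[of 0]
      proof eventually_elim
        case (elim n)
        have "g < (real (record_count x n) + real m) / real n"
          using m[of n] elim by (simp add: less_divide_eq)
        also have "\<dots> \<le> real (Suc (record_count x n)) / real n + real m / real n"
          unfolding add_divide_distrib[symmetric] by (intro divide_right_mono) auto
        finally show ?case using elim g(3) by linarith
      qed
    qed
  qed
  \<comment> \<open>Only countably many tolerances \<open>1 / (j + 1)\<close> are used, so that one
    null set serves for all of them.\<close>
  have "AE x in S. \<forall>j. (\<forall>\<^sub>F n in sequentially. real (Suc (record_count x n)) / real n < stay_prob + 1 / real (Suc j))
      \<and> (\<forall>\<^sub>F n in sequentially. stay_prob - 1 / real (Suc j) < real (Suc (record_count x n)) / real n)"
    using up low by (simp only: AE_all_countable AE_conj_iff) simp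
  then show ?thesis
  proof eventually_elim
    case (elim x)
    show ?case
    proof (rule order_tendstoI)
      fix a assume "a < stay_prob"
      then obtain j where "inverse (real (Suc j)) < stay_prob - a" using reals_Archimedean[of "stay_prob - a"] by auto
      then have le: "a \<le> stay_prob - 1 / real (Suc j)" by (simp add: inverse_eq_divide)
      have "\<forall>\<^sub>F n in sequentially. stay_prob - 1 / real (Suc j) < real (Suc (record_count x n)) / real n"
        using elim by blast
      then show "\<forall>\<^sub>F n in sequentially. a < real (Suc (record_count x n)) / real n"
        by (rule eventually_mono) (rule le_less_trans[OF le])
    next
      fix a assume "stay_prob < a"
      then obtain j where "inverse (real (Suc j)) < a - stay_prob" using reals_Archimedean[of "a - stay_prob"] by auto
      then have le: "stay_prob + 1 / real (Suc j) \<le> a" by (simp add: inverse_eq_divide)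
      have "\<forall>\<^sub>F n in sequentially. real (Suc (record_count x n)) / real n < stay_prob + 1 / real (Suc j)"
        using elim by blast
      then show "\<forall>\<^sub>F n in sequentially. real (Suc (record_count x n)) / real n < a"
        by (rule eventually_mono) (rule less_le_trans[OF _ le])
    qed
  qed
qed

end

section \<open>Random walks\<close>

locale iid_walk = prob_space M for M :: "'a measure" +
  fixes X :: "nat \<Rightarrow> 'a \<Rightarrow> real"
  assumes iid: "iid_nondegenerate_steps M X"
begin

definition step_law :: "real measure" where
  "step_law = distr M borel (X 1)"

definition increments :: "'a \<Rightarrow> nat \<Rightarrow> real" where
  "increments \<omega> = (\<lambda>i. X (Suc i) \<omega>)"

lemma indep_X: "indep_vars (\<lambda>_. borel) X {1..}"
  using iid unfolding iid_nondegenerate_steps_def by blast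

lemma measurable_X: "i \<ge> 1 \<Longrightarrow> X i \<in> borel_measurable M"
  using indep_X by (simp add: indep_vars_def2)

lemma step_law_eq: "i \<ge> 1 \<Longrightarrow> distr M borel (X i) = step_law"
  using iid unfolding iid_nondegenerate_steps_def step_law_def by blast

sublocale steps: random_steps step_law
proof -
  interpret N: prob_space step_law
    unfolding step_law_def by (intro prob_space_distr measurable_X) simp
  show "random_steps step_law"
    by unfold_locales (simp add: step_law_def)
qed

lemma measurable_increments: "increments \<in> measurable M steps.S"
proof (rule measurable_PiM_single')
  show "(\<lambda>\<omega>. increments \<omega> i) \<in> measurable M step_law" for i
    using measurable_X[of "Suc i"] unfolding increments_def measurable_cong_sets[OF refl steps.sets_N] by simp
qed (simp add: increments_def steps.space_S[unfolded space_PiM])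

text \<open>This identity carries every result from the sequence space to \<open>M\<close>.
  Independence gives the product law over the indices from one on, and reindexing along
  \<open>Suc\<close> moves it to all of \<open>nat\<close>.\<close>

lemma distr_increments: "distr M steps.S increments = steps.S"
proof -
  let ?K = "{1..} :: nat set" and ?X = "\<lambda>\<omega>. \<lambda>i\<in>{1..}. X i \<omega>"
  let ?f = "\<lambda>x. \<lambda>i\<in>UNIV. x (Suc i) :: real"
  have X: "?X \<in> measurable M (PiM ?K (\<lambda>_. borel))"
    by (rule measurable_restrict) (simp add: measurable_X)
  have f: "?f \<in> measurable (PiM ?K (\<lambda>_. borel)) (PiM UNIV (\<lambda>_. borel))"
    by (rule measurable_restrict) (simp add: measurable_component_singleton)
  have law: "distr M (PiM ?K (\<lambda>_. borel)) ?X = PiM ?K (\<lambda>_. step_law)"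
  proof -
    have "distr M (PiM ?K (\<lambda>_. borel)) ?X = PiM ?K (\<lambda>i. distr M borel (X i))"
      using indep_X by (subst indep_vars_iff_distr_eq_PiM'[symmetric]) (simp_all add: measurable_X)
    also have "\<dots> = PiM ?K (\<lambda>_. step_law)"
      by (intro PiM_cong) (simp_all add: step_law_eq)
    finally show ?thesis .
  qed
  have "distr M (PiM UNIV (\<lambda>_. borel)) increments = distr M (PiM UNIV (\<lambda>_. borel)) (?f \<circ> ?X)"
    by (intro distr_cong refl) (auto simp: increments_def fun_eq_iff)
  also have "\<dots> = distr (PiM ?K (\<lambda>_. step_law)) (PiM UNIV (\<lambda>_. borel)) ?f"
    using distr_distr[OF f X] by (simp only: law)
  also have "\<dots> = distr (PiM ?K (\<lambda>_. step_law)) steps.S ?f"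
    by (intro distr_cong refl sets_PiM_cong) (simp add: steps.sets_N)
  also have "\<dots> = steps.S"
    using distr_PiM_reindex[of ?K "\<lambda>_. step_law" Suc UNIV] steps.M.prob_space_axioms by simp
  finally have "distr M (\<Pi>\<^sub>M i\<in>UNIV. borel) increments = steps.S" .
  moreover have "distr M (\<Pi>\<^sub>M i\<in>UNIV. borel) increments = distr M steps.S increments"
    by (intro distr_cong refl sets_PiM_cong) (simp add: steps.sets_N)
  ultimately show ?thesis by simp
qed

lemma prob_increments:
  assumes "Measurable.pred steps.S Q"
  shows "prob {\<omega> \<in> space M. Q (increments \<omega>)} = steps.P.prob {x. Q x}"
proof -
  have "steps.P.prob {x. Q x} = measure (distr M steps.S increments) {x. Q x}"
    by (simp only: distr_increments)
  also have "\<dots> = prob (increments -` {x. Q x} \<inter> space M)"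
    by (rule measure_distr[OF measurable_increments steps.pred_sets[OF assms]])
  also have "increments -` {x. Q x} \<inter> space M = {\<omega> \<in> space M. Q (increments \<omega>)}" by auto
  finally show ?thesis ..
qed

lemma AE_increments:
  assumes "Measurable.pred steps.S Q"
  shows "(AE \<omega> in M. Q (increments \<omega>)) \<longleftrightarrow> (AE x in steps.S. Q x)"
proof -
  have "(AE x in distr M steps.S increments. Q x) \<longleftrightarrow> (AE \<omega> in M. Q (increments \<omega>))"
    by (rule AE_distr_iff[OF measurable_increments]) (simp add: steps.space_S steps.pred_sets[OF assms])
  then show ?thesis by (simp only: distr_increments)
qed

section \<open>Records and ladder epoch of the walk in terms of its step sequence\<close>

lemma walk_eq: "walk X n \<omega> = psum (increments \<omega>) n"
  by (simp add: walk_def psum_def increments_def sum.atLeast1_atMost_eq)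

lemma weak_record_at_iff: "weak_record_at X n \<omega> \<longleftrightarrow> is_record (increments \<omega>) n"
proof -
  have "Max ((\<lambda>k. walk X k \<omega>) ` {0..n}) = walk X n \<omega> \<longleftrightarrow> (\<forall>k\<le>n. walk X k \<omega> \<le> walk X n \<omega>)"
    by (subst Max_eq_iff) auto
  then show ?thesis by (auto simp: weak_record_at_def is_record_def walk_eq)
qed

lemma num_records_eq: "num_records X n \<omega> = Suc (record_count (increments \<omega>) n)"
proof -
  have "{k \<in> {0..n}. weak_record_at X k \<omega>} = insert 0 {k \<in> {1..n}. is_record (increments \<omega>) k}"
    by (auto simp: weak_record_at_iff Suc_le_eq)
  then show ?thesis by (simp add: num_records_def record_count_def)
qed

lemma ladder_epoch_alt: "ladder_epoch X \<omega> = Inf (enat ` {n. 1 \<le> n \<and> is_record (increments \<omega>) n})"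
  by (simp add: ladder_epoch_def is_record_def walk_eq Ball_def)

lemma ladder_epoch_enat:
  assumes "first_record (increments \<omega>) k"
  shows "ladder_epoch X \<omega> = enat k"
  unfolding ladder_epoch_alt
proof (rule antisym)
  show "Inf (enat ` {n. 1 \<le> n \<and> is_record (increments \<omega>) n}) \<le> enat k"
    using assms is_record_after[OF assms, of 0] by (intro Inf_lower) (auto simp: first_record_def)
  show "enat k \<le> Inf (enat ` {n. 1 \<le> n \<and> is_record (increments \<omega>) n})"
  proof (rule Inf_greatest)
    fix t assume "t \<in> enat ` {n. 1 \<le> n \<and> is_record (increments \<omega>) n}"
    then obtain n where "t = enat n" "1 \<le> n" "is_record (increments \<omega>) n" by blast
    then show "enat k \<le> t"
      using first_record_not_before[OF assms, of n] by (cases "n < k") auto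
  qed
qed

lemma ladder_epoch_infinity:
  assumes "\<And>k. \<not> first_record (increments \<omega>) k"
  shows "ladder_epoch X \<omega> = \<infinity>"
proof -
  have "\<not> is_record (increments \<omega>) n" if "1 \<le> n" for n
  proof
    assume "is_record (increments \<omega>) n"
    from first_record_exists[OF _ is_record_nonneg[OF this]] that assms show False by auto
  qed
  then have "{n. 1 \<le> n \<and> is_record (increments \<omega>) n} = {}" by blast
  then show ?thesis by (simp add: ladder_epoch_alt Inf_enat_def)
qed

lemma ladder_epoch_eq_iff: "ladder_epoch X \<omega> = enat k \<longleftrightarrow> first_record (increments \<omega>) k"
proof (cases "\<exists>j. first_record (increments \<omega>) j")
  case True
  then obtain j where j: "first_record (increments \<omega>) j" ..
  then show ?thesis using ladder_epoch_enat[OF j] first_record_unique[OF j, of k] by auto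
next
  case False
  then show ?thesis using ladder_epoch_infinity[of \<omega>] by simp
qed

lemma prob_ladder_epoch: "prob {\<omega> \<in> space M. ladder_epoch X \<omega> = enat k} = steps.epoch_prob k"
  unfolding ladder_epoch_eq_iff steps.epoch_prob_def
  by (rule prob_increments[OF steps.measurable_first_record])

text \<open>\<open>enat\<close> is countable, so singletons suffice; the preimage of \<infinity> is
  the complement of the preimages of all finite values.\<close>

lemma measurable_ladder_epoch: "ladder_epoch X \<in> measurable M (count_space UNIV)"
proof (rule measurable_count_space_eq_countable[THEN iffD2])
  show "countable (UNIV :: enat set)" by simp
  have fin: "ladder_epoch X -` {enat k} \<inter> space M \<in> sets M" for k
  proof -
    have "ladder_epoch X -` {enat k} \<inter> space M = increments -` {x. first_record x k} \<inter> space M"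
      using ladder_epoch_eq_iff by auto
    then show ?thesis
      using measurable_sets[OF measurable_increments steps.pred_sets[OF steps.measurable_first_record]] by simp
  qed
  have "ladder_epoch X -` {t} \<inter> space M \<in> sets M" for t
  proof (cases t)
    case infinity
    have "ladder_epoch X -` {t} \<inter> space M = space M - (\<Union>k. ladder_epoch X -` {enat k} \<inter> space M)"
    proof (rule set_eqI)
      fix \<omega>
      show "\<omega> \<in> ladder_epoch X -` {t} \<inter> space M \<longleftrightarrow>
          \<omega> \<in> space M - (\<Union>k. ladder_epoch X -` {enat k} \<inter> space M)"
        unfolding infinity by (cases "ladder_epoch X \<omega>") auto
    qed
    also have "\<dots> \<in> sets M" using fin by (intro sets.compl_sets sets.countable_UN) auto
    finally show ?thesis .
  qed (simp add: fin)
  then show "ladder_epoch X \<in> space M \<rightarrow> UNIV \<and> (\<forall>t\<in>UNIV. ladder_epoch X -` {t} \<inter> space M \<in> sets M)"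
    by simp
qed

lemma ladder_epoch_sets: "{\<omega> \<in> space M. ladder_epoch X \<omega> = enat k} \<in> sets M"
  using measurable_sets[OF measurable_ladder_epoch, of "{enat k}"] by (simp add: vimage_def Int_def conj_commute)

text \<open>For \<open>l < 0\<close> the value \<infinity> contributes zero by the convention in
  \<open>exp_enat\<close>, so the integrand is a series over the finite values; a geometric series
  justifies integrating termwise.\<close>

lemma integral_exp_enat:
  assumes "l < 0"
  shows "(\<integral>\<omega>. exp_enat l (ladder_epoch X \<omega>) \<partial>M) = (\<Sum>k. steps.epoch_prob k * exp (l * real k))"
proof -
  let ?A = "\<lambda>k. {\<omega> \<in> space M. ladder_epoch X \<omega> = enat k}"
  let ?f = "\<lambda>k \<omega>. indicator (?A k) \<omega> * exp (l * real k) :: real"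
  note A = ladder_epoch_sets
  have int: "integrable M (?f k)" for k
    using A by (intro integrable_mult_left integrable_real_indicator) (auto simp: emeasure_finite less_top[symmetric])
  have sums: "(\<lambda>k. ?f k \<omega>) sums exp_enat l (ladder_epoch X \<omega>)" if "\<omega> \<in> space M" for \<omega>
  proof (cases "ladder_epoch X \<omega>")
    case (enat n)
    then have "(\<lambda>k. ?f k \<omega>) = (\<lambda>k. if k = n then exp (l * real k) else 0)"
      using that by auto
    then show ?thesis using sums_single[of n "\<lambda>k. exp (l * real k)"] enat by (simp add: exp_enat_def)
  next
    case infinity
    then show ?thesis using assms by (simp add: exp_enat_def)
  qed
  have eq: "(\<integral>\<omega>. ?f k \<omega> \<partial>M) = steps.epoch_prob k * exp (l * real k)" for k
    using A by (simp add: prob_ladder_epoch)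
  have "summable (\<lambda>k. exp l ^ k)" using assms by (intro summable_geometric) simp
  then have summ: "summable (\<lambda>k. steps.epoch_prob k * exp (l * real k))"
    by (rule summable_comparison_test') (simp add: steps.epoch_prob_def exp_of_nat2_mult mult_left_le_one_le)
  have "(\<integral>\<omega>. exp_enat l (ladder_epoch X \<omega>) \<partial>M) = (\<integral>\<omega>. (\<Sum>k. ?f k \<omega>) \<partial>M)"
    using sums by (intro Bochner_Integration.integral_cong) (simp_all add: sums_iff)
  also have "\<dots> = (\<Sum>k. \<integral>\<omega>. ?f k \<omega> \<partial>M)"
  proof (rule integral_suminf[OF int])
    show "AE \<omega> in M. summable (\<lambda>k. norm (?f k \<omega>))"
      using sums by (intro AE_I2) (auto simp: sums_iff)
    show "summable (\<lambda>k. \<integral>\<omega>. norm (?f k \<omega>) \<partial>M)" using summ eq by simp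
  qed
  finally show ?thesis by (simp only: eq)
qed

end

locale recurrent_walk = iid_walk +
  assumes recurrent: "AE \<omega> in M. \<exists>n>0. 0 \<le> walk X n \<omega>"
begin

sublocale steps: recurrent_steps step_law
proof unfold_locales
  have "Measurable.pred steps.S (\<lambda>x. \<exists>n>0. 0 \<le> psum x n)"
    by measurable
  from AE_increments[OF this] show "AE x in steps.S. \<exists>n>0. 0 \<le> psum x n"
    using recurrent by (simp add: walk_eq)
qed

lemma log_mgf_eq:
  assumes "l \<le> 0"
  shows "log_mgf M X l = steps.W.Lam l"
proof (cases "l = 0")
  case True
  have "exp_enat 0 t = 1" for t by (cases t) (simp_all add: exp_enat_def)
  then show ?thesis
    using True prob_space by (simp add: log_mgf_def steps.W.Lam_def steps.W.Phi_0)
next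
  case False
  then show ?thesis
    using assms by (simp add: log_mgf_def steps.W.Lam_def steps.W.Phi_def integral_exp_enat)
qed

lemma rate_eq: "rate M X y = steps.W.legendre y"
  unfolding rate_def steps.W.legendre_def by (intro SUP_cong) (simp_all add: log_mgf_eq)

text \<open>\<open>log_mgf\<close> is known to agree with \<open>Lam\<close> for
  \<open>l \<le> 0\<close>; around a point \<open>l < 0\<close> this is a whole neighbourhood, so
  the derivative carries over.\<close>

lemma log_mgf_deriv:
  assumes "l < 0"
  shows "(log_mgf M X has_real_derivative steps.W.Phi' l / steps.W.Phi l) (at l)"
  by (rule DERIV_cong_ev[THEN iffD1, OF refl _ refl steps.W.Lam_deriv[OF assms]])
    (use assms in \<open>auto simp: log_mgf_eq intro!: eventually_mono[OF eventually_nhds_in_open[of "{..<0}"]]\<close>)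

lemma log_mgf_differentiable: "l < 0 \<Longrightarrow> log_mgf M X differentiable at l"
  using log_mgf_deriv real_differentiable_def by blast

lemma deriv_log_mgf_iff: "l < 0 \<Longrightarrow> deriv (log_mgf M X) l = y \<longleftrightarrow> steps.W.tilt y l = 0"
  using DERIV_imp_deriv[OF log_mgf_deriv] DERIV_imp_deriv[OF steps.W.Lam_deriv] steps.W.deriv_Lam[of l y] by simp

text \<open>\<open>inv_into\<close> selects some preimage of \<open>y\<close>. It is again a root of
  \<open>tilt y\<close>, hence a maximiser in the Legendre transform, and the root is
  unique.\<close>

lemma rate_legendre:
  assumes "1 < y" "y < (\<Sum>j<J. steps.R.tail j)"
  shows "(\<exists>!l. l < 0 \<and> deriv (log_mgf M X) l = y) \<and>
    rate M X y = ereal (inv_deriv_log_mgf M X y * y - log_mgf M X (inv_deriv_log_mgf M X y))"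
proof -
  from steps.tilt_root[OF assms] obtain l where l: "l < 0" "steps.W.tilt y l = 0" by blast
  then have img: "y \<in> deriv (log_mgf M X) ` {..<0}" using deriv_log_mgf_iff[of l y] by force
  define m where "m = inv_deriv_log_mgf M X y"
  have m: "m < 0" "deriv (log_mgf M X) m = y"
    using inv_into_into[OF img] f_inv_into_f[OF img] by (simp_all add: m_def inv_deriv_log_mgf_def)
  then have t: "steps.W.tilt y m = 0" using deriv_log_mgf_iff by blast
  have "\<exists>!l. l < 0 \<and> deriv (log_mgf M X) l = y"
    using m steps.W.tilt_root_unique[OF assms(1)] deriv_log_mgf_iff by metis
  moreover have "rate M X y = ereal (m * y - log_mgf M X m)"
    using steps.W.legendre_root[OF assms(1) m(1) t] m(1) by (simp add: rate_eq log_mgf_eq)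
  ultimately show ?thesis by (simp add: m_def)
qed

text \<open>\<open>T = 1\<close> happens exactly when the first step is nonnegative, and the
  positivity of this probability keeps \<open>elog\<close> finite.\<close>

lemma rate_one: "rate M X 1 = - elog (prob {\<omega> \<in> space M. X 1 \<omega> \<ge> 0})"
proof -
  have "prob {\<omega> \<in> space M. X 1 \<omega> \<ge> 0} = prob {\<omega> \<in> space M. 0 \<le> psum (increments \<omega>) 1}"
    by (simp add: psum_def increments_def)
  also have "\<dots> = steps.epoch_prob 1"
    by (subst prob_increments[OF steps.measurable_psum_nonneg]) (simp only: steps.epoch_prob_1_eq, simp add: psum_def)
  finally show ?thesis
    using steps.epoch_prob_1_pos by (simp add: rate_eq steps.W.legendre_one elog_def)
qed

lemma rate_below_one: "y < 1 \<Longrightarrow> rate M X y = \<infinity>"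
  by (simp add: rate_eq steps.W.legendre_below_one)

lemma num_records_ldp:
  assumes y: "0 < y" "y \<le> 1" and J: "y < 1 \<Longrightarrow> 1 / y < (\<Sum>j<J. steps.R.tail j)"
  shows "(\<lambda>n. ereal (1 / real n) * elog (prob {\<omega> \<in> space M. real (num_records X n \<omega>) \<ge> real n * y}))
    \<longlonglongrightarrow> - (ereal y * rate M X (1 / y))"
proof -
  have "Measurable.pred steps.S (\<lambda>x. real (Suc (record_count x n)) \<ge> real n * y)" for n
    using measurable_compose[OF steps.measurable_record_count measurable_count_space[of "\<lambda>k. real (Suc k) \<ge> real n * y"]] .
  from prob_increments[OF this] steps.record_ldp[OF assms] show ?thesis
    by (simp only: num_records_eq rate_eq)
qed

lemma tail_eq: "emeasure M {\<omega> \<in> space M. enat n < ladder_epoch X \<omega>} = ennreal (steps.R.tail n)"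
proof -
  let ?A = "\<lambda>k. {\<omega> \<in> space M. ladder_epoch X \<omega> = enat k}"
  note A = ladder_epoch_sets
  have "{\<omega> \<in> space M. enat n < ladder_epoch X \<omega>} = space M - (\<Union>k\<le>n. ?A k)"
  proof (intro set_eqI iffI)
    fix \<omega> assume "\<omega> \<in> space M - (\<Union>k\<le>n. ?A k)"
    then show "\<omega> \<in> {\<omega> \<in> space M. enat n < ladder_epoch X \<omega>}"
      by (cases "ladder_epoch X \<omega>") (auto simp: not_le[symmetric])
  qed auto
  moreover have "prob (space M - (\<Union>k\<le>n. ?A k)) = 1 - prob (\<Union>k\<le>n. ?A k)"
    using A by (intro prob_compl) auto
  moreover have "prob (\<Union>k\<le>n. ?A k) = (\<Sum>k\<le>n. prob (?A k))"
    using A by (intro finite_measure_finite_Union) (auto simp: disjoint_family_on_def)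
  ultimately show ?thesis
    by (simp add: emeasure_eq_measure prob_ladder_epoch steps.R.tail_def)
qed

lemma mean_ladder_epoch_eq: "mean_ladder_epoch M X = (\<Sum>n. ennreal (steps.R.tail n))"
  unfolding mean_ladder_epoch_def nn_integral_enat_function[OF measurable_ladder_epoch] by (simp add: tail_eq)

lemma prob_walk_neg: "prob {\<omega> \<in> space M. walk X (Suc k) \<omega> < 0} = 1 - steps.nonneg_prob (Suc k)"
proof -
  have "prob {\<omega> \<in> space M. walk X (Suc k) \<omega> < 0} = steps.P.prob {x. psum x (Suc k) < 0}"
    unfolding walk_eq by (rule prob_increments[OF steps.measurable_psum_neg])
  also have "{x. psum x (Suc k) < 0} = space steps.S - {x. 0 \<le> psum x (Suc k)}"
    by (auto simp: steps.space_S)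
  also have "steps.P.prob \<dots> = 1 - steps.nonneg_prob (Suc k)"
    by (subst steps.P.prob_compl) (simp_all add: steps.pred_sets[OF steps.measurable_psum_nonneg] steps.nonneg_prob_def)
  finally show ?thesis .
qed

lemma num_records_rate:
  assumes "steps.stay_prob > 0"
  shows "AE \<omega> in M. (\<lambda>n. real (num_records X n \<omega>) / real n) \<longlonglongrightarrow> steps.stay_prob"
  unfolding num_records_eq
  by (rule AE_distrD[OF measurable_increments]) (simp only: distr_increments steps.record_rate[OF assms])

text \<open>Bounded partial sums would make \<open>tail\<close> summable with
  \<open>stay_prob\<close> times its sum equal to one. Thus every level has a certificate when
  \<open>stay_prob = 0\<close>.\<close>

lemma tail_unbounded:
  assumes "steps.stay_prob = 0"
  shows "\<exists>J. y < (\<Sum>j<J. steps.R.tail j)"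
proof (rule ccontr)
  assume "\<nexists>J. y < (\<Sum>j<J. steps.R.tail j)"
  then have "summable steps.R.tail"
    by (intro summableI_nonneg_bounded[OF steps.R.tail_nonneg, of _ y]) (simp add: not_less)
  from steps.R.suminf_tail[OF this] show False by (simp add: assms)
qed

end

section \<open>Oscillation and drift to infinity\<close>

lemma (in iid_walk) oscillating_recurrent:
  assumes "oscillates M X"
  shows "recurrent_walk M X"
proof unfold_locales
  show "AE \<omega> in M. \<exists>n>0. 0 \<le> walk X n \<omega>"
    using assms unfolding oscillates_def
  proof eventually_elim
    case (elim \<omega>)
    show ?case
    proof (rule ccontr)
      assume "\<not> ?case"
      then have "\<forall>\<^sub>F n in sequentially. ereal (walk X n \<omega>) \<le> 0"
        by (intro eventually_sequentiallyI[of 1]) (metis ereal_less_eq(5) less_imp_le less_one linorder_not_less not_gr_zero)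
      then have "limsup (\<lambda>n. ereal (walk X n \<omega>)) \<le> 0" by (rule Limsup_bounded)
      then show False using elim by simp
    qed
  qed
qed

lemma (in recurrent_walk) oscillating_stay_prob:
  assumes "oscillates M X"
  shows "steps.stay_prob = 0"
proof (rule steps.stay_prob_0)
  have "AE \<omega> in M. \<exists>k. psum (increments \<omega>) k < 0"
    using assms unfolding oscillates_def walk_eq
  proof eventually_elim
    case (elim \<omega>)
    show ?case
    proof (rule ccontr)
      assume "\<not> ?case"
      then have "\<forall>\<^sub>F n in sequentially. 0 \<le> ereal (psum (increments \<omega>) n)"
        by (intro always_eventually) (auto simp: not_less)
      then have "0 \<le> liminf (\<lambda>n. ereal (psum (increments \<omega>) n))" by (rule Liminf_bounded)
      then show False using elim by simp
    qed
  qed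
  moreover have "Measurable.pred steps.S (\<lambda>x. \<exists>k. psum x k < 0)"
    by (intro pred_intros_countable steps.measurable_psum_neg)
  ultimately show "AE x in steps.S. \<exists>k. psum x k < 0" using AE_increments by blast
qed

lemma (in iid_walk) drifting_recurrent:
  assumes "drifts_to_infinity M X"
  shows "recurrent_walk M X"
proof unfold_locales
  show "AE \<omega> in M. \<exists>n>0. 0 \<le> walk X n \<omega>"
    using assms unfolding drifts_to_infinity_def
  proof eventually_elim
    case (elim \<omega>)
    then have "\<forall>\<^sub>F n in sequentially. 0 \<le> walk X n \<omega>" by (simp add: filterlim_at_top)
    then have "\<forall>\<^sub>F n in sequentially. n > 0 \<and> 0 \<le> walk X n \<omega>"
      by (intro eventually_conj eventually_gt_at_top)
    then show ?case using eventually_happens'[OF sequentially_bot] by blast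
  qed
qed

text \<open>A path that tends to infinity attains its minimum: from some \<open>K\<close> on it is
  nonnegative, whereas the minimum over \<open>{..K}\<close> is at most its value \<open>0\<close>
  at time \<open>0\<close>.\<close>

lemma (in recurrent_walk) drifting_stay_prob:
  assumes "drifts_to_infinity M X"
  shows "steps.stay_prob > 0"
proof (rule steps.stay_prob_pos_if_argmin)
  have "AE \<omega> in M. \<exists>m. \<forall>k. psum (increments \<omega>) m \<le> psum (increments \<omega>) (m + k)"
    using assms unfolding drifts_to_infinity_def walk_eq
  proof eventually_elim
    case (elim \<omega>)
    let ?s = "psum (increments \<omega>)"
    have "\<forall>\<^sub>F n in sequentially. 0 \<le> ?s n" using elim by (simp add: filterlim_at_top)
    then obtain K where K: "\<And>n. n \<ge> K \<Longrightarrow> 0 \<le> ?s n" by (auto simp: eventually_sequentially)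
    have "Min (?s ` {..K}) \<in> ?s ` {..K}" by (intro Min_in) auto
    then obtain m where m: "Min (?s ` {..K}) = ?s m" by (rule imageE)
    have le: "?s m \<le> ?s n" if "n \<le> K" for n
      unfolding m[symmetric] using that by (intro Min_le) auto
    have "?s m \<le> ?s n" for n
    proof (cases "n \<le> K")
      case False
      have "?s m \<le> ?s 0" by (rule le) simp
      then show ?thesis using K[of n] False by simp
    qed (rule le)
    then show ?case by blast
  qed
  moreover have "Measurable.pred steps.S (\<lambda>x. \<exists>m. \<forall>k. psum x m \<le> psum x (m + k))"
    by (intro pred_intros_countable steps.measurable_psum_le)
  ultimately show "AE x in steps.S. \<exists>m. \<forall>k. psum x m \<le> psum x (m + k)" using AE_increments by blast
qed

text \<open>All parts reflect that the mean is the sum of \<open>tail\<close>, finite by positivity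
  of \<open>stay_prob\<close>. The last one turns a level below the mean into a certificate for the
  root arguments.\<close>

lemma (in recurrent_walk) mean_ladder_epoch:
  assumes "steps.stay_prob > 0"
  shows "mean_ladder_epoch M X < \<infinity>"
    and "summable (\<lambda>k. measure M {\<omega> \<in> space M. walk X (Suc k) \<omega> < 0} / real (Suc k))"
    and "mean_ladder_epoch M X =
      ennreal (exp (\<Sum>k. measure M {\<omega> \<in> space M. walk X (Suc k) \<omega> < 0} / real (Suc k)))"
    and "1 / enn2real (mean_ladder_epoch M X) = steps.stay_prob"
    and "y < enn2real (mean_ladder_epoch M X) \<Longrightarrow> \<exists>J. y < (\<Sum>j<J. steps.R.tail j)"
proof -
  have tail: "summable steps.R.tail" "steps.stay_prob * (\<Sum>n. steps.R.tail n) = 1"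
    using steps.R.summable_tail[OF assms] steps.R.suminf_tail by auto
  have pos: "0 \<le> (\<Sum>n. steps.R.tail n)" by (intro suminf_nonneg tail(1) steps.R.tail_nonneg)
  have mean: "mean_ladder_epoch M X = ennreal (\<Sum>n. steps.R.tail n)"
    unfolding mean_ladder_epoch_eq by (rule suminf_ennreal2[OF steps.R.tail_nonneg tail(1)])
  then have real_mean: "enn2real (mean_ladder_epoch M X) = (\<Sum>n. steps.R.tail n)"
    using pos by simp
  show "mean_ladder_epoch M X < \<infinity>" by (simp add: mean)
  show "summable (\<lambda>k. measure M {\<omega> \<in> space M. walk X (Suc k) \<omega> < 0} / real (Suc k))"
    unfolding prob_walk_neg by (rule steps.R.spitzer_formula(1)[OF tail(1)])
  show "mean_ladder_epoch M X =
      ennreal (exp (\<Sum>k. measure M {\<omega> \<in> space M. walk X (Suc k) \<omega> < 0} / real (Suc k)))"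
    unfolding prob_walk_neg mean steps.R.spitzer_formula(2)[OF tail(1)] ..
  show "1 / enn2real (mean_ladder_epoch M X) = steps.stay_prob"
    unfolding real_mean using tail(2) assms by (metis nonzero_eq_divide_eq mult_zero_right zero_neq_one)
  assume "y < enn2real (mean_ladder_epoch M X)"
  then have "\<forall>\<^sub>F J in sequentially. y < (\<Sum>j<J. steps.R.tail j)"
    unfolding real_mean using summable_LIMSEQ[OF tail(1)] by (intro order_tendstoD)
  then show "\<exists>J. y < (\<Sum>j<J. steps.R.tail j)"
    using eventually_happens'[OF sequentially_bot] by blast
qed

theorem theorem6:
  fixes M :: "'a measure" and X :: "nat \<Rightarrow> 'a \<Rightarrow> real"
  assumes "prob_space M"
    and "iid_nondegenerate_steps M X"
  shows
    "(oscillates M X \<longrightarrow>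
       (\<forall>y. 0 < y \<and> y \<le> 1 \<longrightarrow>
          (\<lambda>n. ereal (1 / real n) *
               elog (measure M {\<omega> \<in> space M. real (num_records X n \<omega>) \<ge> real n * y}))
            \<longlonglongrightarrow> - (ereal y * rate M X (1 / y))) \<and>
       (\<forall>l<0. log_mgf M X differentiable at l) \<and>
       (\<forall>y>1. (\<exists>!l. l < 0 \<and> deriv (log_mgf M X) l = y) \<and>
          rate M X y = ereal (inv_deriv_log_mgf M X y * y
                              - log_mgf M X (inv_deriv_log_mgf M X y))) \<and>
       rate M X 1 = - elog (measure M {\<omega> \<in> space M. X 1 \<omega> \<ge> 0}) \<and>
       (\<forall>y<1. rate M X y = \<infinity>))
     \<and>
     (drifts_to_infinity M X \<longrightarrow>
       mean_ladder_epoch M X < \<infinity> \<and>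
       summable (\<lambda>k. measure M {\<omega> \<in> space M. walk X (Suc k) \<omega> < 0} / real (Suc k)) \<and>
       mean_ladder_epoch M X =
         ennreal (exp (\<Sum>k. measure M {\<omega> \<in> space M. walk X (Suc k) \<omega> < 0} / real (Suc k))) \<and>
       (AE \<omega> in M. (\<lambda>n. real (num_records X n \<omega>) / real n)
                     \<longlonglongrightarrow> 1 / enn2real (mean_ladder_epoch M X)) \<and>
       (\<forall>y. 1 / enn2real (mean_ladder_epoch M X) < y \<and> y \<le> 1 \<longrightarrow>
          (\<lambda>n. ereal (1 / real n) *
               elog (measure M {\<omega> \<in> space M. real (num_records X n \<omega>) \<ge> real n * y}))
            \<longlonglongrightarrow> - (ereal y * rate M X (1 / y))) \<and>
       (\<forall>l<0. log_mgf M X differentiable at l) \<and>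
       (\<forall>y. 1 < y \<and> y < enn2real (mean_ladder_epoch M X) \<longrightarrow>
          (\<exists>!l. l < 0 \<and> deriv (log_mgf M X) l = y) \<and>
          rate M X y = ereal (inv_deriv_log_mgf M X y * y
                              - log_mgf M X (inv_deriv_log_mgf M X y))) \<and>
       rate M X 1 = - elog (measure M {\<omega> \<in> space M. X 1 \<omega> \<ge> 0}) \<and>
       (\<forall>y<1. rate M X y = \<infinity>))"
proof (intro conjI impI)
  interpret iid_walk M X
    using assms by (simp add: iid_walk_def iid_walk_axioms_def)
  {
    assume osc: "oscillates M X"
    interpret recurrent_walk M X by (rule oscillating_recurrent[OF osc])
    \<comment> \<open>The mean is infinite here, so a certificate exists for every level.\<close>
    note J = tail_unbounded[OF oscillating_stay_prob[OF osc]]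
    show "\<forall>y. 0 < y \<and> y \<le> 1 \<longrightarrow>
          (\<lambda>n. ereal (1 / real n) *
               elog (measure M {\<omega> \<in> space M. real (num_records X n \<omega>) \<ge> real n * y}))
            \<longlonglongrightarrow> - (ereal y * rate M X (1 / y))"
      using num_records_ldp J by blast
    show "\<forall>l<0. log_mgf M X differentiable at l"
      using log_mgf_differentiable by blast
    show "\<forall>y>1. (\<exists>!l. l < 0 \<and> deriv (log_mgf M X) l = y) \<and>
          rate M X y = ereal (inv_deriv_log_mgf M X y * y
                              - log_mgf M X (inv_deriv_log_mgf M X y))"
      using rate_legendre J by blast
    show "rate M X 1 = - elog (measure M {\<omega> \<in> space M. X 1 \<omega> \<ge> 0})"
      by (rule rate_one)
    show "\<forall>y<1. rate M X y = \<infinity>"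
      using rate_below_one by blast
  }
  {
    assume drift: "drifts_to_infinity M X"
    interpret recurrent_walk M X by (rule drifting_recurrent[OF drift])
    note stay = drifting_stay_prob[OF drift]
    note mean = mean_ladder_epoch[OF stay]
    show "mean_ladder_epoch M X < \<infinity>" by (rule mean)
    show "summable (\<lambda>k. measure M {\<omega> \<in> space M. walk X (Suc k) \<omega> < 0} / real (Suc k))"
      by (rule mean)
    show "mean_ladder_epoch M X =
         ennreal (exp (\<Sum>k. measure M {\<omega> \<in> space M. walk X (Suc k) \<omega> < 0} / real (Suc k)))"
      by (rule mean)
    show "AE \<omega> in M. (\<lambda>n. real (num_records X n \<omega>) / real n)
                     \<longlonglongrightarrow> 1 / enn2real (mean_ladder_epoch M X)"
      unfolding mean(4) by (rule num_records_rate[OF stay])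
    show "\<forall>y. 1 / enn2real (mean_ladder_epoch M X) < y \<and> y \<le> 1 \<longrightarrow>
          (\<lambda>n. ereal (1 / real n) *
               elog (measure M {\<omega> \<in> space M. real (num_records X n \<omega>) \<ge> real n * y}))
            \<longlonglongrightarrow> - (ereal y * rate M X (1 / y))"
    proof (intro allI impI)
      fix y assume y: "1 / enn2real (mean_ladder_epoch M X) < y \<and> y \<le> 1"
      \<comment> \<open>The lower limit for \<open>y\<close> is \<open>stay_prob\<close>, which is
        positive.\<close>
      then have "0 < y" using stay unfolding mean(4) by simp
      have "0 < enn2real (mean_ladder_epoch M X)"
        using stay mean(4) by (metis enn2real_nonneg divide_eq_0_iff less_irrefl order_le_less)
      then have "1 / y < enn2real (mean_ladder_epoch M X)"
        using y \<open>0 < y\<close> by (simp add: divide_less_eq mult.commute)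
      then obtain J where "1 / y < (\<Sum>j<J. steps.R.tail j)"
        using mean(5) by blast
      then show "(\<lambda>n. ereal (1 / real n) *
               elog (measure M {\<omega> \<in> space M. real (num_records X n \<omega>) \<ge> real n * y}))
            \<longlonglongrightarrow> - (ereal y * rate M X (1 / y))"
        using y \<open>0 < y\<close> by (intro num_records_ldp) auto
    qed
    show "\<forall>l<0. log_mgf M X differentiable at l"
      using log_mgf_differentiable by blast
    show "\<forall>y. 1 < y \<and> y < enn2real (mean_ladder_epoch M X) \<longrightarrow>
          (\<exists>!l. l < 0 \<and> deriv (log_mgf M X) l = y) \<and>
          rate M X y = ereal (inv_deriv_log_mgf M X y * y
                              - log_mgf M X (inv_deriv_log_mgf M X y))"
    proof (intro allI impI)
      fix y assume y: "1 < y \<and> y < enn2real (mean_ladder_epoch M X)"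
      then obtain J where "y < (\<Sum>j<J. steps.R.tail j)"
        using mean(5) by blast
      with y show "(\<exists>!l. l < 0 \<and> deriv (log_mgf M X) l = y) \<and>
          rate M X y = ereal (inv_deriv_log_mgf M X y * y
                              - log_mgf M X (inv_deriv_log_mgf M X y))"
        by (intro rate_legendre) auto
    qed
    show "rate M X 1 = - elog (measure M {\<omega> \<in> space M. X 1 \<omega> \<ge> 0})"
      by (rule rate_one)
    show "\<forall>y<1. rate M X y = \<infinity>"
      using rate_below_one by blast
  }
qed

end
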